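(* Let $X$ be a $2$-dimensional real Banach space that is not smooth. Then $X$ has the Mazur--Ulam property; that is, for every Banach space $Y$, every isometry $f:S_X\to S_Y$ of $S_X$ onto $S_Y$ extends to a linear isometry of the Banach spaces $X,Y$.
   Context: All Banach spaces are over $\mathbb R$. For a Banach space $(X,\|\cdot\|)$, $S_X=\{x\in X:\|x\|=1\}$ is its unit sphere, with the metric $\|x-y\|$. $X$ is smooth if for every $x\in S_X$ there exists a unique linear continuous functional $x^*:X\to\mathbb R$ with $x^*(x)=1=\|x^*\|$. $X$ has the Mazur--Ulam property if every isometry (distance-preserving map) $f:S_X\to S_Y$ of $S_X$ onto the unit sphere $S_Y$ of an arbitrary Banach space $Y$ extends to a linear isometry of the Banach spaces $X,Y$. *)

theory Defs
  imports "HOL-Analysis.Analysis"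
begin

definition smooth_space :: "'a::real_normed_vector itself \<Rightarrow> bool" where
  "smooth_space _ \<longleftrightarrow>
     (\<forall>x\<in>sphere (0::'a) 1. \<exists>!\<phi>::'a \<Rightarrow>\<^sub>L real. blinfun_apply \<phi> x = 1 \<and> norm \<phi> = 1)"

definition isometry_on :: "'a::metric_space set \<Rightarrow> ('a \<Rightarrow> 'b::metric_space) \<Rightarrow> bool" where
  "isometry_on S f \<longleftrightarrow> (\<forall>x\<in>S. \<forall>y\<in>S. dist (f x) (f y) = dist x y)"

(* The target space Y enters as a type parameter, since a HOL formula cannot quantify over types.
   X has the Mazur-Ulam property iff this holds with 'b a free (hence universally quantified)
   type variable. Only the values of f on the unit sphere matter; the extension is the function F. *)
definition Mazur_Ulam_property :: "'a::banach itself \<Rightarrow> 'b::banach itself \<Rightarrow> bool" where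
  "Mazur_Ulam_property _ _ \<longleftrightarrow>
     (\<forall>f::'a \<Rightarrow> 'b. isometry_on (sphere 0 1) f \<and> f ` sphere 0 1 = sphere 0 1 \<longrightarrow>
        (\<exists>F::'a \<Rightarrow> 'b. linear F \<and> isometry_on UNIV F \<and> surj F \<and> (\<forall>x\<in>sphere 0 1. F x = f x)))"

end

theory Submission
  imports Defs
begin

text \<open>
  Let \<open>p\<close> be a corner of the unit sphere \<open>S\<close> of \<open>X\<close>, let \<open>q = f p\<close>, and let \<open>B\<close>, \<open>C\<close> be the
  one-sided tangent vectors of \<open>S\<close> at \<open>p\<close>, pointing into the two branches.  As \<open>f\<close> is a
  homeomorphism preserving chord lengths, it has one-sided derivatives \<open>B'\<close>, \<open>C'\<close> at \<open>p\<close>, and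

  \<^item> comparing distances between points on the two branches near \<open>p\<close> gives
    \<open>\<parallel>\<beta>B - \<gamma>C\<parallel> = \<parallel>\<beta>B' - \<gamma>C'\<parallel>\<close> for \<open>\<beta>, \<gamma> > 0\<close>;

  \<^item> the directions of the chords \<open>v = z - p\<close> with \<open>z \<in> S\<close> fill the cone spanned by \<open>B\<close> and \<open>C\<close>,
    and the directional derivatives of the norm at \<open>v\<close> along \<open>-B\<close> and \<open>-C\<close> are metric data of
    \<open>S\<close>, hence the same for \<open>f z - q\<close>; since the norm on the cone is the supremum of the functionals
    with these derivatives, \<open>\<parallel>\<beta>B + \<gamma>C\<parallel> \<le> \<parallel>\<beta>B' + \<gamma>C'\<parallel>\<close>, and equality follows by symmetry.

  So \<open>B \<mapsto> B'\<close>, \<open>C \<mapsto> C'\<close> defines a linear isometry \<open>T\<close>.  A corner is determined by its tangent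
  cone, so \<open>T p = q\<close>.  Finally \<open>T\<inverse> \<circ> f\<close> fixes \<open>p\<close> and acts on \<open>S - {p}\<close>, a copy of the line, as an
  increasing bijection; an orbit is monotone, hence converges in \<open>S\<close>, while consecutive points keep a
  constant distance, so this distance is \<open>0\<close> and \<open>f = T\<close> on \<open>S\<close>.
\<close>

section \<open>One-sided directional derivatives of the norm\<close>

text \<open>The right derivative of the norm at \<open>v\<close> along \<open>x\<close>. By
  convexity the quotients increase with \<open>t\<close>, so the infimum is also the limit at 0 from
  the right, and it needs no existence argument.\<close>

definition ddir :: "'a::real_normed_vector \<Rightarrow> 'a \<Rightarrow> real" where
  "ddir v x = Inf ((\<lambda>t. (norm (v + t *\<^sub>R x) - norm v) / t) ` {0<..})"

lemma norm_quotient_mono: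
  fixes v x :: "'a::real_normed_vector"
  assumes "0 < s" "s \<le> t"
  shows "(norm (v + s *\<^sub>R x) - norm v) / s \<le> (norm (v + t *\<^sub>R x) - norm v) / t"
proof -
  have "v + s *\<^sub>R x = (1 - s / t) *\<^sub>R v + (s / t) *\<^sub>R (v + t *\<^sub>R x)"
    using assms by (simp add: algebra_simps)
  then have "norm (v + s *\<^sub>R x) \<le> norm ((1 - s / t) *\<^sub>R v) + norm ((s / t) *\<^sub>R (v + t *\<^sub>R x))"
    by (metis norm_triangle_ineq)
  also have "\<dots> = (1 - s / t) * norm v + (s / t) * norm (v + t *\<^sub>R x)"
    using assms by simp
  finally show ?thesis
    using assms by (simp add: field_simps)
qed

lemma norm_quotient_ge:
  fixes v x :: "'a::real_normed_vector"
  assumes "0 < t"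
  shows "- norm x \<le> (norm (v + t *\<^sub>R x) - norm v) / t"
proof -
  have "norm v \<le> norm (v + t *\<^sub>R x) + norm (t *\<^sub>R x)"
    by (metis add_diff_cancel_right' norm_triangle_ineq4)
  then show ?thesis
    using assms by (simp add: field_simps)
qed

lemma ddir_le_quotient:
  assumes "0 < t"
  shows "ddir v x \<le> (norm (v + t *\<^sub>R x) - norm v) / t"
  unfolding ddir_def
  by (rule cINF_lower) (use assms norm_quotient_ge[of _ x v] in \<open>auto intro!: bdd_belowI2\<close>)

lemma ddir_tendsto:
  "((\<lambda>t. (norm (v + t *\<^sub>R x) - norm v) / t) \<longlongrightarrow> ddir v x) (at_right 0)"
proof (rule order_tendstoI)
  fix a assume "a < ddir v x"
  moreover have "\<forall>\<^sub>F t::real in at_right 0. 0 < t"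
    by (simp add: eventually_at_right_less)
  ultimately show "\<forall>\<^sub>F t in at_right 0. a < (norm (v + t *\<^sub>R x) - norm v) / t"
    using ddir_le_quotient[of _ v x] by (auto elim!: eventually_mono intro: less_le_trans)
next
  fix a assume "ddir v x < a"
  then obtain t where t: "t > 0" "(norm (v + t *\<^sub>R x) - norm v) / t < a"
    unfolding ddir_def using norm_quotient_ge[of _ x v]
    by (subst (asm) cINF_less_iff) (auto intro!: bdd_belowI2)
  show "\<forall>\<^sub>F t in at_right 0. (norm (v + t *\<^sub>R x) - norm v) / t < a"
    unfolding eventually_at_right_field
    by (rule exI[of _ t]) (use t norm_quotient_mono[of _ t v x] in \<open>auto intro!: le_less_trans[OF _ t(2)]\<close>)
qed

lemma ddir_eqI:
  assumes "((\<lambda>t. (norm (v + t *\<^sub>R x) - norm v) / t) \<longlongrightarrow> l) (at_right 0)"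
  shows "ddir v x = l"
  using tendsto_unique[OF _ ddir_tendsto assms] by simp

lemma ddir_le_norm: "ddir v x \<le> norm x"
proof -
  have "ddir v x \<le> (norm (v + 1 *\<^sub>R x) - norm v) / 1"
    by (rule ddir_le_quotient) simp
  then show ?thesis
    using norm_triangle_ineq[of v x] by simp
qed

lemma ddir_zero [simp]: "ddir v 0 = 0"
  by (rule ddir_eqI) simp

lemma ddir_scaleR:
  assumes "0 \<le> c"
  shows "ddir v (c *\<^sub>R x) = c * ddir v x"
proof (cases "c = 0")
  case False
  with assms have c: "c > 0" by simp
  have "filterlim (\<lambda>t. t * c) (at_right 0) (at_right 0)"
    unfolding filterlim_at
    using c by (auto intro!: tendsto_eq_intros eventually_at_right_less simp: eventually_at_filter)
  from tendsto_mult[OF tendsto_const[of c] filterlim_compose[OF ddir_tendsto[of v x] this]]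
  have "((\<lambda>t. c * ((norm (v + (t * c) *\<^sub>R x) - norm v) / (t * c))) \<longlongrightarrow> c * ddir v x) (at_right 0)" .
  then show ?thesis
    using c by (intro ddir_eqI) simp
qed simp

text \<open>Midpoint convexity: \<open>v + t *\<^sub>R (x + y)\<close> lies halfway between
  \<open>v + t *\<^sub>R (2 *\<^sub>R x)\<close> and \<open>v + t *\<^sub>R (2 *\<^sub>R y)\<close>;
  positive homogeneity then removes the factor 2.\<close>

lemma ddir_add_le: "ddir v (x + y) \<le> ddir v x + ddir v y"
proof (rule tendsto_le[OF _ _ ddir_tendsto])
  have "((\<lambda>t. (norm (v + t *\<^sub>R (2 *\<^sub>R x)) - norm v) / t / 2 + (norm (v + t *\<^sub>R (2 *\<^sub>R y)) - norm v) / t / 2)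
     \<longlongrightarrow> ddir v (2 *\<^sub>R x) / 2 + ddir v (2 *\<^sub>R y) / 2) (at_right 0)"
    by (intro tendsto_intros ddir_tendsto) auto
  then show "((\<lambda>t. (norm (v + t *\<^sub>R (2 *\<^sub>R x)) - norm v) / t / 2 + (norm (v + t *\<^sub>R (2 *\<^sub>R y)) - norm v) / t / 2)
     \<longlongrightarrow> ddir v x + ddir v y) (at_right 0)"
    by (simp add: ddir_scaleR)
  have "(norm (v + t *\<^sub>R (x + y)) - norm v) / t \<le>
     (norm (v + t *\<^sub>R (2 *\<^sub>R x)) - norm v) / t / 2 + (norm (v + t *\<^sub>R (2 *\<^sub>R y)) - norm v) / t / 2"
    if "t > 0" for t
  proof -
    have "2 *\<^sub>R (v + t *\<^sub>R (x + y)) = (v + t *\<^sub>R (2 *\<^sub>R x)) + (v + t *\<^sub>R (2 *\<^sub>R y))"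
      by (simp only: scaleR_2 scaleR_add_right add.assoc add.left_commute add.commute)
    then have "2 * norm (v + t *\<^sub>R (x + y)) \<le> norm (v + t *\<^sub>R (2 *\<^sub>R x)) + norm (v + t *\<^sub>R (2 *\<^sub>R y))"
      by (metis norm_triangle_ineq norm_scaleR abs_numeral)
    then have "(norm (v + t *\<^sub>R (x + y)) - norm v) / t
        \<le> ((norm (v + t *\<^sub>R (2 *\<^sub>R x)) + norm (v + t *\<^sub>R (2 *\<^sub>R y))) / 2 - norm v) / t"
      using that by (intro divide_right_mono) auto
    then show ?thesis
      by (simp add: add_divide_distrib diff_divide_distrib)
  qed
  then show "\<forall>\<^sub>F t in at_right 0. (norm (v + t *\<^sub>R (x + y)) - norm v) / t \<le>
     (norm (v + t *\<^sub>R (2 *\<^sub>R x)) - norm v) / t / 2 + (norm (v + t *\<^sub>R (2 *\<^sub>R y)) - norm v) / t / 2"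
    by (auto simp: eventually_at_right_less intro: eventually_mono[OF eventually_at_right_less])
qed simp

lemma ddir_self: "ddir v (c *\<^sub>R v) = c * norm v"
proof (rule ddir_eqI)
  have "\<forall>\<^sub>F t in at_right 0. 1 + t * c > (0::real)"
    by (rule order_tendstoD(1)[where y = 1]) (auto intro!: tendsto_eq_intros)
  then have "\<forall>\<^sub>F t in at_right 0. c * norm v = (norm (v + t *\<^sub>R (c *\<^sub>R v)) - norm v) / t"
    using eventually_at_right_less[of "0::real"]
  proof eventually_elim
    case (elim t)
    have "v + t *\<^sub>R (c *\<^sub>R v) = (1 + t * c) *\<^sub>R v"
      by (simp add: algebra_simps)
    then have "norm (v + t *\<^sub>R (c *\<^sub>R v)) = (1 + t * c) * norm v"
      using elim by (simp only: norm_scaleR abs_of_pos)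
    then show ?case
      using elim by (simp add: field_simps)
  qed
  then show "((\<lambda>t. (norm (v + t *\<^sub>R (c *\<^sub>R v)) - norm v) / t) \<longlongrightarrow> c * norm v) (at_right 0)"
    by (rule Lim_transform_eventually[OF tendsto_const])
qed

text \<open>Along multiples of \<open>v\<close> of either sign the derivative is linear, so
  subadditivity can be used once with \<open>c\<close> and once with \<open>- c\<close>.\<close>

lemma ddir_shift: "ddir v (c *\<^sub>R v + y) = c * norm v + ddir v y"
proof (rule antisym)
  show "ddir v (c *\<^sub>R v + y) \<le> c * norm v + ddir v y"
    using ddir_add_le[of v "c *\<^sub>R v" y] by (simp add: ddir_self)
  show "c * norm v + ddir v y \<le> ddir v (c *\<^sub>R v + y)"
    using ddir_add_le[of v "(- c) *\<^sub>R v" "c *\<^sub>R v + y"] by (simp only: ddir_self) simp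
qed

lemma ddir_add_minus_nonneg: "0 \<le> ddir v x + ddir v (- x)"
  using ddir_add_le[of v x "- x"] by simp

text \<open>The norm is 1-Lipschitz, so replacing the curve by its tangent line changes the quotient
  by at most \<open>norm ((g t - p) /\<^sub>R t - B)\<close>. The left side involves only distances,
  hence is preserved by isometries when \<open>z\<close>, \<open>p\<close> and \<open>g t\<close>
  lie on the sphere.\<close>

lemma tendsto_ddir_chord:
  assumes "((\<lambda>t. (g t - p) /\<^sub>R t) \<longlongrightarrow> B) (at_right 0)"
  shows "((\<lambda>t. (norm (z - g t) - norm (z - p)) / t) \<longlongrightarrow> ddir (z - p) (- B)) (at_right 0)"
proof -
  have *: "((\<lambda>t. (norm ((z - p) + t *\<^sub>R (- B)) - norm (z - p)) / t) \<longlongrightarrow> ddir (z - p) (- B)) (at_right 0)"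
    by (rule ddir_tendsto)
  have "((\<lambda>t. (norm (z - g t) - norm (z - p)) / t - (norm ((z - p) + t *\<^sub>R (- B)) - norm (z - p)) / t)
    \<longlongrightarrow> 0) (at_right 0)"
  proof (rule Lim_null_comparison)
    show "((\<lambda>t. norm ((g t - p) /\<^sub>R t - B)) \<longlongrightarrow> 0) (at_right 0)"
      using assms by (simp add: LIM_zero_iff tendsto_norm_zero)
    show "\<forall>\<^sub>F t in at_right 0. norm ((norm (z - g t) - norm (z - p)) / t
        - (norm ((z - p) + t *\<^sub>R (- B)) - norm (z - p)) / t) \<le> norm ((g t - p) /\<^sub>R t - B)"
      using eventually_at_right_less
    proof eventually_elim
      case (elim t)
      have "\<bar>norm (z - g t) - norm ((z - p) + t *\<^sub>R (- B))\<bar> \<le> norm ((z - g t) - ((z - p) + t *\<^sub>R (- B)))"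
        by (rule norm_triangle_ineq3)
      also have "(z - g t) - ((z - p) + t *\<^sub>R (- B)) = (- t) *\<^sub>R ((g t - p) /\<^sub>R t - B)"
        using elim by (simp add: algebra_simps)
      finally have "\<bar>norm (z - g t) - norm ((z - p) + t *\<^sub>R (- B))\<bar> \<le> t * norm ((g t - p) /\<^sub>R t - B)"
        using elim by simp
      then show ?case
        using elim by (simp add: diff_divide_distrib[symmetric] field_simps)
    qed
  qed
  from tendsto_add[OF this *] show ?thesis by simp
qed

text \<open>Lets a chord of the sphere be replaced by any positive multiple of it.\<close>

lemma ddir_scaleR_base:
  assumes "0 < s"
  shows "ddir (s *\<^sub>R v) x = ddir v x"
proof -
  have lim: "((\<lambda>t. s * ((norm (v + t *\<^sub>R x) - norm v) / t)) \<longlongrightarrow> s * ddir v x) (at_right 0)"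
    by (intro tendsto_intros ddir_tendsto)
  have eq: "s * ((norm (v + t *\<^sub>R x) - norm v) / t)
      = (norm (s *\<^sub>R v + t *\<^sub>R (s *\<^sub>R x)) - norm (s *\<^sub>R v)) / t" for t
  proof -
    have "s *\<^sub>R v + t *\<^sub>R (s *\<^sub>R x) = s *\<^sub>R (v + t *\<^sub>R x)"
      by (simp add: scaleR_add_right mult.commute)
    then have "norm (s *\<^sub>R v + t *\<^sub>R (s *\<^sub>R x)) = s * norm (v + t *\<^sub>R x)"
      using assms by (simp only: norm_scaleR abs_of_pos)
    then show ?thesis
      using assms by (simp add: right_diff_distrib)
  qed
  have "ddir (s *\<^sub>R v) (s *\<^sub>R x) = s * ddir v x"
    using lim unfolding eq by (rule ddir_eqI)
  then show ?thesis
    using assms by (simp add: ddir_scaleR)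
qed

section \<open>Planes with a unit basis vector\<close>

text \<open>Bounded coordinates take the place of a dimension hypothesis. The vector
  \<open>e\<close> is any direction transversal to \<open>p\<close>; its sign only tells apart the
  two branches of the sphere at \<open>p\<close>.\<close>

locale plane =
  fixes p e :: "'a::real_normed_vector" and \<xi> \<eta> :: "'a \<Rightarrow> real"
  assumes norm_p [simp]: "norm p = 1"
    and bounded_linear_\<xi>: "bounded_linear \<xi>" and bounded_linear_\<eta>: "bounded_linear \<eta>"
    and coords: "x = \<xi> x *\<^sub>R p + \<eta> x *\<^sub>R e"
    and coords_basis [simp]: "\<xi> p = 1" "\<xi> e = 0" "\<eta> p = 0" "\<eta> e = 1"
begin

lemma coords_simps [simp]:
  "\<xi> (x + y) = \<xi> x + \<xi> y" "\<eta> (x + y) = \<eta> x + \<eta> y"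
  "\<xi> (x - y) = \<xi> x - \<xi> y" "\<eta> (x - y) = \<eta> x - \<eta> y"
  "\<xi> (- x) = - \<xi> x" "\<eta> (- x) = - \<eta> x"
  "\<xi> (c *\<^sub>R x) = c * \<xi> x" "\<eta> (c *\<^sub>R x) = c * \<eta> x"
  "\<xi> 0 = 0" "\<eta> 0 = 0"
proof -
  interpret c: bounded_linear \<xi> by (rule bounded_linear_\<xi>)
  interpret d: bounded_linear \<eta> by (rule bounded_linear_\<eta>)
  show "\<xi> (x + y) = \<xi> x + \<xi> y" "\<eta> (x + y) = \<eta> x + \<eta> y"
    "\<xi> (x - y) = \<xi> x - \<xi> y" "\<eta> (x - y) = \<eta> x - \<eta> y"
    "\<xi> (- x) = - \<xi> x" "\<eta> (- x) = - \<eta> x"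
    "\<xi> (c *\<^sub>R x) = c * \<xi> x" "\<eta> (c *\<^sub>R x) = c * \<eta> x"
    "\<xi> 0 = 0" "\<eta> 0 = 0"
    by (simp_all add: c.add d.add c.diff d.diff c.neg d.neg c.scaleR d.scaleR)
qed

lemma continuous_coords: "continuous_on A \<xi>" "continuous_on A \<eta>"
  by (simp_all add: linear_continuous_on bounded_linear_\<xi> bounded_linear_\<eta>)

lemma plane_minus: "plane p (- e) \<xi> (\<lambda>x. - \<eta> x)"
  using coords bounded_linear_\<xi> bounded_linear_minus[OF bounded_linear_\<eta>] by (simp add: plane_def)

end

lemma span_pair: "x \<in> span {p, e} \<longleftrightarrow> (\<exists>a b. x = a *\<^sub>R p + b *\<^sub>R e)"
proof -
  have "x \<in> span {p, e} \<longleftrightarrow> (\<exists>a b. x - a *\<^sub>R p = b *\<^sub>R e)"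
    unfolding span_breakdown_eq[of x p "{e}"] span_singleton by blast
  then show ?thesis
    by (simp add: diff_eq_eq add.commute)
qed

text \<open>The algebraic coordinates have to be shown bounded. The distance \<open>m\<close> from
  \<open>e\<close> to the line through \<open>p\<close> is attained, hence positive, and homogeneity
  gives \<open>m * \<bar>\<eta> x\<bar> \<le> norm x\<close>; the bound for \<open>\<xi>\<close>
  follows.\<close>

lemma ex_plane:
  fixes p e :: "'a::real_normed_vector"
  assumes p: "norm p = 1" and e: "e \<notin> span {p}" and span: "\<And>x. x \<in> span {p, e}"
  shows "\<exists>\<xi> \<eta>. plane p e \<xi> \<eta>"
proof -
  have "e \<noteq> p" using e span_base[of p "{p}"] by auto
  moreover have "independent {p}" using p by auto
  ultimately have ind: "independent {p, e}"
    using e independent_insert[of e "{p}"] by (simp add: insert_commute)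
  obtain \<xi> where \<xi>: "linear \<xi>" "\<forall>x\<in>{p, e}. \<xi> x = (if x = p then 1 else 0 :: real)"
    using linear_independent_extend[OF ind, of "\<lambda>x. if x = p then 1 else 0"] by blast
  obtain \<eta> where \<eta>: "linear \<eta>" "\<forall>x\<in>{p, e}. \<eta> x = (if x = p then 0 else 1 :: real)"
    using linear_independent_extend[OF ind, of "\<lambda>x. if x = p then 0 else 1"] by blast
  have basis: "\<xi> p = 1" "\<xi> e = 0" "\<eta> p = 0" "\<eta> e = 1"
    using \<xi>(2) \<eta>(2) \<open>e \<noteq> p\<close> by auto
  have coords: "x = \<xi> x *\<^sub>R p + \<eta> x *\<^sub>R e" for x
  proof -
    obtain a b where "x = a *\<^sub>R p + b *\<^sub>R e"
      using span[of x] unfolding span_pair by auto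
    then show ?thesis
      using basis by (simp add: linear_add[OF \<xi>(1)] linear_add[OF \<eta>(1)] linear_scale[OF \<xi>(1)] linear_scale[OF \<eta>(1)])
  qed
  \<comment> \<open>Outside this interval \<open>norm (e + b *\<^sub>R p)\<close> exceeds
    \<open>norm e\<close>, its value at \<open>b = 0\<close>, so the minimum over the compact
    interval is the minimum over the whole line.\<close>
  have "\<exists>a\<in>{-2 * norm e..2 * norm e}. \<forall>b\<in>{-2 * norm e..2 * norm e}. norm (e + a *\<^sub>R p) \<le> norm (e + b *\<^sub>R p)"
    by (rule continuous_attains_inf) (auto intro!: continuous_intros)
  then obtain a where a: "\<And>b. \<bar>b\<bar> \<le> 2 * norm e \<Longrightarrow> norm (e + a *\<^sub>R p) \<le> norm (e + b *\<^sub>R p)"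
    by (metis abs_le_iff atLeastAtMost_iff minus_le_iff mult_minus_left)
  define m where "m = norm (e + a *\<^sub>R p)"
  have "m > 0"
  proof -
    have "e + a *\<^sub>R p \<noteq> 0"
    proof
      assume "e + a *\<^sub>R p = 0"
      then have "e = (- a) *\<^sub>R p" by (simp add: eq_neg_iff_add_eq_0)
      with e show False by (metis span_base span_scale singletonI)
    qed
    then show ?thesis by (simp add: m_def)
  qed
  have m: "m \<le> norm (e + b *\<^sub>R p)" for b
  proof (cases "\<bar>b\<bar> \<le> 2 * norm e")
    case False
    have "m \<le> norm e" using a[of 0] by (simp add: m_def)
    also have "\<dots> \<le> \<bar>b\<bar> - norm e" using False by simp
    also have "\<dots> \<le> norm (e + b *\<^sub>R p)"
      using norm_diff_ineq[of "b *\<^sub>R p" e] p by (simp add: add.commute)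
    finally show ?thesis .
  qed (use a m_def in auto)
  have bound: "m * \<bar>\<eta> x\<bar> \<le> norm x" for x
  proof (cases "\<eta> x = 0")
    case False
    have "m * \<bar>\<eta> x\<bar> \<le> norm (e + (\<xi> x / \<eta> x) *\<^sub>R p) * \<bar>\<eta> x\<bar>"
      using m by (intro mult_right_mono) auto
    also have "\<dots> = norm (\<eta> x *\<^sub>R (e + (\<xi> x / \<eta> x) *\<^sub>R p))" by simp
    also have "\<eta> x *\<^sub>R (e + (\<xi> x / \<eta> x) *\<^sub>R p) = x"
      using False by (subst (4) coords) (simp add: algebra_simps)
    finally show ?thesis .
  qed simp
  have "norm (\<eta> x) \<le> norm x * (1 / m)" for x
    using bound[of x] \<open>m > 0\<close> by (simp add: field_simps)
  then have bl\<eta>: "bounded_linear \<eta>"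
    using \<eta>(1) by (intro bounded_linear_intro[where K = "1 / m"]) (auto simp: linear_add linear_scale)
  have "norm (\<xi> x) \<le> norm x * (1 + norm e / m)" for x
  proof -
    have "\<bar>\<xi> x\<bar> = norm (x - \<eta> x *\<^sub>R e)"
      using p by (subst (2) coords) simp
    also have "\<dots> \<le> norm x + \<bar>\<eta> x\<bar> * norm e"
      using norm_triangle_ineq4[of x "\<eta> x *\<^sub>R e"] by simp
    also have "\<bar>\<eta> x\<bar> * norm e \<le> (norm x / m) * norm e"
      using bound[of x] \<open>m > 0\<close> by (intro mult_right_mono) (auto simp: field_simps)
    finally show ?thesis by (simp add: algebra_simps)
  qed
  then have "bounded_linear \<xi>"
    using \<xi>(1) by (intro bounded_linear_intro[where K = "1 + norm e / m"]) (auto simp: linear_add linear_scale)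
  then show ?thesis
    using p coords basis bl\<eta> unfolding plane_def by blast
qed

lemma ex_plane_of_dim_2:
  fixes p :: "'a::real_normed_vector"
  assumes dim: "dim (UNIV :: 'a set) = 2" and p: "norm p = 1"
  shows "\<exists>e \<xi> \<eta>. plane p e \<xi> \<eta>"
proof -
  let ?B = "extend_basis {p}"
  have ind: "independent {p}" using p by auto
  note B = extend_basis_superset[OF ind] independent_extend_basis[OF ind] span_extend_basis[OF ind]
  have "card ?B = 2"
    using dim_eq_card[of ?B UNIV] B dim by simp
  then obtain e where e: "?B = {p, e}" "p \<noteq> e"
    using B(1) unfolding card_2_iff by (metis insert_commute insert_iff singletonD subset_iff)
  then have "e \<notin> span {p}"
    using B(2) by (auto simp: insert_commute[of p e] independent_insert)
  then show ?thesis
    using ex_plane[OF p, of e] B(3) e by auto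
qed

section \<open>Arcs and tangent vectors of the unit sphere\<close>

text \<open>The derivative from the right at 0 of the radial projection of
  \<open>p + t *\<^sub>R e\<close> to the sphere, for a unit vector \<open>p\<close>. In general
  \<open>tang p (- e)\<close> is not \<open>- tang p e\<close>.\<close>

definition tang :: "'a::real_normed_vector \<Rightarrow> 'a \<Rightarrow> 'a" where
  "tang p e = e - ddir p e *\<^sub>R p"

text \<open>The term \<open>t\<^sup>2 / 4\<close> makes this a reparametrization of the stereographic chart \<open>stereo\<close> below near
  infinity, without changing the tangent vector at \<open>p\<close>.\<close>

definition sphere_arc :: "'a::real_normed_vector \<Rightarrow> 'a \<Rightarrow> real \<Rightarrow> 'a" where
  "sphere_arc p e t = sgn ((1 - t\<^sup>2 / 4) *\<^sub>R p + t *\<^sub>R e)"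

text \<open>Stereographic projection from \<open>p\<close>, with the circle pushed radially to the unit sphere; the
  point \<open>p\<close> corresponds to both ends of the line.\<close>

definition stereo :: "'a::real_normed_vector \<Rightarrow> 'a \<Rightarrow> real \<Rightarrow> 'a" where
  "stereo p e s = sgn ((s\<^sup>2 - 1) *\<^sub>R p + (2 * s) *\<^sub>R e)"

lemma stereo_minus: "stereo p (- e) s = stereo p e (- s)"
  by (simp add: stereo_def)

lemma stereo_inverse:
  assumes "t > 0"
  shows "stereo p e (2 / t) = sphere_arc p e t"
proof -
  have "((2 / t)\<^sup>2 - 1) *\<^sub>R p + (2 * (2 / t)) *\<^sub>R e = (4 / t\<^sup>2) *\<^sub>R ((1 - t\<^sup>2 / 4) *\<^sub>R p + t *\<^sub>R e)"
    using assms by (simp add: scaleR_add_right power2_eq_square field_simps)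
  then show ?thesis
    using assms by (simp add: stereo_def sphere_arc_def sgn_scaleR)
qed

text \<open>The quadratic term moves the norm by at most \<open>t\<^sup>2 / 4\<close>, so the vector
  being normalized has norm \<open>1 + t * ddir p e + o(t)\<close>; dividing by it produces the
  radial correction in \<open>tang\<close>.\<close>

lemma sphere_arc_tangent:
  assumes p: "norm p = 1"
  shows "((\<lambda>t. (sphere_arc p e t - p) /\<^sub>R t) \<longlongrightarrow> tang p e) (at_right 0)"
proof -
  define y where "y t = (1 - t\<^sup>2 / 4) *\<^sub>R p + t *\<^sub>R e" for t
  have q: "((\<lambda>t. (norm (y t) - 1) / t) \<longlongrightarrow> ddir p e) (at_right 0)"
  proof -
    have "((\<lambda>t. (norm (y t) - 1) / t - (norm (p + t *\<^sub>R e) - norm p) / t) \<longlongrightarrow> 0) (at_right 0)"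
    proof (rule Lim_null_comparison)
      show "((\<lambda>t::real. t / 4) \<longlongrightarrow> 0) (at_right 0)"
        by (auto intro!: tendsto_eq_intros)
      show "\<forall>\<^sub>F t in at_right 0. norm ((norm (y t) - 1) / t - (norm (p + t *\<^sub>R e) - norm p) / t) \<le> t / 4"
        using eventually_at_right_less
      proof eventually_elim
        case (elim t)
        have "y t - (p + t *\<^sub>R e) = (- (t\<^sup>2 / 4)) *\<^sub>R p"
          by (simp add: y_def algebra_simps)
        then have "\<bar>norm (y t) - norm (p + t *\<^sub>R e)\<bar> \<le> t\<^sup>2 / 4"
          using norm_triangle_ineq3[of "y t" "p + t *\<^sub>R e"] p by simp
        then have "\<bar>norm (y t) - norm (p + t *\<^sub>R e)\<bar> / t \<le> t / 4"
          using elim by (simp add: field_simps power2_eq_square)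
        then show ?case
          using elim p by (simp add: diff_divide_distrib[symmetric])
      qed
    qed
    from tendsto_add[OF this ddir_tendsto[of p e]] show ?thesis by simp
  qed
  have y1: "((\<lambda>t. norm (y t)) \<longlongrightarrow> 1) (at_right 0)"
    unfolding y_def using p by (auto intro!: tendsto_eq_intros)
  have lim: "((\<lambda>t. (e - (t / 4) *\<^sub>R p - ((norm (y t) - 1) / t) *\<^sub>R p) /\<^sub>R norm (y t))
      \<longlongrightarrow> (e - (0 / 4) *\<^sub>R p - ddir p e *\<^sub>R p) /\<^sub>R 1) (at_right 0)"
    by (intro tendsto_intros q y1) auto
  have "\<forall>\<^sub>F t in at_right 0. norm (y t) > 0"
    using order_tendstoD(1)[OF y1, of 0] by simp
  then have ev: "\<forall>\<^sub>F t in at_right 0. (e - (t / 4) *\<^sub>R p - ((norm (y t) - 1) / t) *\<^sub>R p) /\<^sub>R norm (y t)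
      = (sphere_arc p e t - p) /\<^sub>R t"
    using eventually_at_right_less[of "0::real"]
  proof eventually_elim
    case (elim t)
    define n where "n = norm (y t)"
    have "y t - n *\<^sub>R p = t *\<^sub>R (e - (t / 4) *\<^sub>R p - ((n - 1) / t) *\<^sub>R p)"
      using elim by (simp add: y_def scaleR_diff_right scaleR_diff_left power2_eq_square)
    then have "(e - (t / 4) *\<^sub>R p - ((norm (y t) - 1) / t) *\<^sub>R p) /\<^sub>R norm (y t)
       = ((y t - norm (y t) *\<^sub>R p) /\<^sub>R norm (y t)) /\<^sub>R t"
      using elim by (simp add: n_def)
    also have "(y t - norm (y t) *\<^sub>R p) /\<^sub>R norm (y t) = sphere_arc p e t - p"
      using elim unfolding sphere_arc_def y_def[symmetric] sgn_div_norm
      by (simp add: scaleR_diff_right)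
    finally show ?case .
  qed
  show ?thesis
    using Lim_transform_eventually[OF lim ev] by (simp add: tang_def)
qed

lemma tendsto_of_tangent:
  fixes g :: "real \<Rightarrow> 'a::real_normed_vector"
  assumes "((\<lambda>t. (g t - p) /\<^sub>R t) \<longlongrightarrow> B) (at_right 0)"
  shows "(g \<longlongrightarrow> p) (at_right 0)"
proof -
  have lim: "((\<lambda>t. p + t *\<^sub>R ((g t - p) /\<^sub>R t)) \<longlongrightarrow> p + 0 *\<^sub>R B) (at_right 0)"
    by (intro tendsto_intros assms)
  have ev: "\<forall>\<^sub>F t in at_right 0. p + t *\<^sub>R ((g t - p) /\<^sub>R t) = g t"
    by (rule eventually_mono[OF eventually_at_right_less]) simp
  show ?thesis
    using Lim_transform_eventually[OF lim ev] by simp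
qed

lemma stereo_tendsto_at_top:
  assumes "norm p = 1"
  shows "(stereo p e \<longlongrightarrow> p) at_top"
proof -
  have lim: "filterlim (\<lambda>s::real. 2 / s) (at_right 0) at_top"
    unfolding filterlim_at
    by (auto intro!: tendsto_eq_intros eventually_mono[OF eventually_gt_at_top[of 0]]
        tendsto_divide_0 filterlim_at_top_imp_at_infinity filterlim_ident)
  have "((\<lambda>s. sphere_arc p e (2 / s)) \<longlongrightarrow> p) at_top"
    by (rule filterlim_compose[OF tendsto_of_tangent[OF sphere_arc_tangent[OF assms]] lim])
  moreover have "\<forall>\<^sub>F s in at_top. sphere_arc p e (2 / s) = stereo p e s"
    using eventually_gt_at_top[of 0]
    by eventually_elim (simp add: stereo_inverse[symmetric])
  ultimately show ?thesis
    by (rule Lim_transform_eventually)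
qed

section \<open>The stereographic chart of the sphere without \<open>p\<close>\<close>

context plane
begin

text \<open>Classical stereographic projection from (1, 0), applied after rescaling the coordinate
  vector of \<open>z\<close> to Euclidean length 1.\<close>

definition unstereo :: "'a \<Rightarrow> real" where
  "unstereo z = \<eta> z / (sqrt ((\<xi> z)\<^sup>2 + (\<eta> z)\<^sup>2) - \<xi> z)"

lemma stereo_vector_nonzero: "(s\<^sup>2 - 1) *\<^sub>R p + (2 * s) *\<^sub>R e \<noteq> 0"
proof
  assume "(s\<^sup>2 - 1) *\<^sub>R p + (2 * s) *\<^sub>R e = 0"
  then have "\<xi> ((s\<^sup>2 - 1) *\<^sub>R p + (2 * s) *\<^sub>R e) = 0" "\<eta> ((s\<^sup>2 - 1) *\<^sub>R p + (2 * s) *\<^sub>R e) = 0"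
    by simp_all
  then show False by simp
qed

lemma norm_stereo [simp]: "norm (stereo p e s) = 1"
  using stereo_vector_nonzero by (simp add: stereo_def norm_sgn)

lemma stereo_coords:
  obtains c where "c > 0" "\<xi> (stereo p e s) = c * (s\<^sup>2 - 1)" "\<eta> (stereo p e s) = c * (2 * s)"
proof
  show "inverse (norm ((s\<^sup>2 - 1) *\<^sub>R p + (2 * s) *\<^sub>R e)) > 0"
    using stereo_vector_nonzero by simp
qed (simp_all add: stereo_def sgn_div_norm)

lemma stereo_neq: "stereo p e s \<noteq> p"
proof
  assume *: "stereo p e s = p"
  obtain c where c: "c > 0" "\<xi> (stereo p e s) = c * (s\<^sup>2 - 1)" "\<eta> (stereo p e s) = c * (2 * s)"
    using stereo_coords .
  then have "s = 0" using * by simp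
  then show False using c * by simp
qed

lemma unstereo_stereo: "unstereo (stereo p e s) = s"
proof -
  obtain c where c: "c > 0" "\<xi> (stereo p e s) = c * (s\<^sup>2 - 1)" "\<eta> (stereo p e s) = c * (2 * s)"
    using stereo_coords .
  have "(c * (s\<^sup>2 - 1))\<^sup>2 + (c * (2 * s))\<^sup>2 = (c * (s\<^sup>2 + 1))\<^sup>2"
    by (simp add: power2_eq_square algebra_simps)
  then have "sqrt ((c * (s\<^sup>2 - 1))\<^sup>2 + (c * (2 * s))\<^sup>2) = c * (s\<^sup>2 + 1)"
    using c(1) by (simp add: real_sqrt_unique)
  moreover have "c * (s\<^sup>2 + 1) - c * (s\<^sup>2 - 1) = 2 * c"
    by (simp add: algebra_simps)
  ultimately show ?thesis
    using c by (simp add: unstereo_def)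
qed

text \<open>The denominator vanishes only on the closed ray from 0 through \<open>p\<close>, which
  meets the sphere in \<open>p\<close> alone.\<close>

lemma unstereo_denominator_pos:
  assumes "norm z = 1" "z \<noteq> p"
  shows "sqrt ((\<xi> z)\<^sup>2 + (\<eta> z)\<^sup>2) - \<xi> z > 0"
proof (cases "\<eta> z = 0")
  case True
  then have z: "z = \<xi> z *\<^sub>R p" by (subst coords) simp
  then have "\<bar>\<xi> z\<bar> = 1" using assms(1) by (metis norm_p norm_scaleR mult.right_neutral)
  moreover have "\<xi> z \<noteq> 1" using z assms(2) by auto
  ultimately have "\<xi> z = -1" by linarith
  then show ?thesis using True by simp
next
  case False
  then have "\<bar>\<xi> z\<bar> < sqrt ((\<xi> z)\<^sup>2 + (\<eta> z)\<^sup>2)"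
    by (intro real_less_rsqrt) simp
  then show ?thesis by linarith
qed

lemma stereo_unstereo:
  assumes "norm z = 1" "z \<noteq> p"
  shows "stereo p e (unstereo z) = z"
proof -
  define r where "r = sqrt ((\<xi> z)\<^sup>2 + (\<eta> z)\<^sup>2)"
  have d: "r - \<xi> z > 0" using unstereo_denominator_pos[OF assms] by (simp add: r_def)
  have u: "unstereo z = \<eta> z / (r - \<xi> z)" by (simp add: unstereo_def r_def)
  have "r\<^sup>2 = (\<xi> z)\<^sup>2 + (\<eta> z)\<^sup>2" by (simp add: r_def)
  then have "(\<eta> z)\<^sup>2 = (r + \<xi> z) * (r - \<xi> z)" by (simp add: power2_eq_square algebra_simps)
  then have "(unstereo z)\<^sup>2 = (r + \<xi> z) / (r - \<xi> z)"
    using d by (simp add: u power_divide power2_eq_square[of "r - \<xi> z"])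
  then have 1: "(unstereo z)\<^sup>2 - 1 = (2 / (r - \<xi> z)) * \<xi> z"
    using d by (simp add: field_simps)
  have 2: "2 * unstereo z = (2 / (r - \<xi> z)) * \<eta> z"
    by (simp add: u)
  have "((unstereo z)\<^sup>2 - 1) *\<^sub>R p + (2 * unstereo z) *\<^sub>R e
      = (2 / (r - \<xi> z)) *\<^sub>R (\<xi> z *\<^sub>R p + \<eta> z *\<^sub>R e)"
    unfolding 1 2 by (simp add: scaleR_add_right)
  also have "\<dots> = (2 / (r - \<xi> z)) *\<^sub>R z"
    using coords[of z] by simp
  finally show ?thesis
    using d assms(1) by (simp add: stereo_def sgn_scaleR) (simp add: sgn_div_norm)
qed

lemma continuous_on_unstereo: "continuous_on (sphere 0 1 - {p}) unstereo"
  unfolding unstereo_def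
  using unstereo_denominator_pos by (intro continuous_intros continuous_coords) force

lemma continuous_on_stereo: "continuous_on UNIV (stereo p e)"
  unfolding stereo_def using stereo_vector_nonzero
  by (intro continuous_on_sgn continuous_intros) auto

end

section \<open>The tangent cone at a corner\<close>

lemma tang_add_tang_minus: "tang p e + tang p (- e) = - (ddir p e + ddir p (- e)) *\<^sub>R p"
  by (simp add: tang_def algebra_simps)

text \<open>The norm decreases at first along a direction inside the cone, so the ray from
  \<open>p\<close> enters the open ball; being unbounded, it crosses the sphere again.\<close>

lemma tangent_cone_chord:
  assumes p: "norm p = 1" and corner: "ddir p e + ddir p (- e) > 0" and pos: "0 < \<beta>" "0 < \<gamma>"
  shows "\<exists>s>0. norm (p + s *\<^sub>R (\<beta> *\<^sub>R tang p e + \<gamma> *\<^sub>R tang p (- e))) = 1"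
proof -
  define c where "c = \<beta> * ddir p e + \<gamma> * ddir p (- e)"
  define u where "u = \<beta> *\<^sub>R tang p e + \<gamma> *\<^sub>R tang p (- e)"
  have u: "u = (- c) *\<^sub>R p + (\<beta> - \<gamma>) *\<^sub>R e"
    by (simp add: u_def c_def tang_def algebra_simps)
  \<comment> \<open>\<open>ddir p\<close> is only positively homogeneous, so the multiple of
    \<open>e\<close> in \<open>u\<close> is taken along \<open>e\<close> or \<open>- e\<close>
    according to its sign. The result is \<open>- min \<beta> \<gamma>\<close> times
    \<open>ddir p e + ddir p (- e)\<close>.\<close>
  have "ddir p u < 0"
  proof (cases "\<gamma> \<le> \<beta>")
    case True
    then have "ddir p ((\<beta> - \<gamma>) *\<^sub>R e) = (\<beta> - \<gamma>) * ddir p e"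
      by (simp add: ddir_scaleR)
    then have "ddir p u = - \<gamma> * (ddir p e + ddir p (- e))"
      unfolding u ddir_shift by (simp add: p c_def left_diff_distrib right_diff_distrib distrib_left)
    then show ?thesis using corner pos by (simp add: mult_pos_pos)
  next
    case False
    have "(\<beta> - \<gamma>) *\<^sub>R e = (\<gamma> - \<beta>) *\<^sub>R (- e)" by (simp add: algebra_simps)
    then have "ddir p ((\<beta> - \<gamma>) *\<^sub>R e) = (\<gamma> - \<beta>) * ddir p (- e)"
      using False by (simp only: ddir_scaleR)
    then have "ddir p u = - \<beta> * (ddir p e + ddir p (- e))"
      unfolding u ddir_shift by (simp add: p c_def left_diff_distrib right_diff_distrib distrib_left)
    then show ?thesis using corner pos by (simp add: mult_pos_pos)
  qed
  then have "u \<noteq> 0" by auto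
  have "\<forall>\<^sub>F t in at_right 0. (norm (p + t *\<^sub>R u) - norm p) / t < 0 \<and> 0 < t"
    using order_tendstoD(2)[OF ddir_tendsto \<open>ddir p u < 0\<close>] eventually_at_right_less
    by eventually_elim simp
  then obtain t where "(norm (p + t *\<^sub>R u) - norm p) / t < 0" "0 < t"
    using eventually_happens[of _ "at_right (0::real)"] by auto
  then have t: "norm (p + t *\<^sub>R u) < 1" "0 < t"
    using p by (simp_all add: divide_less_0_iff)
  \<comment> \<open>The second summand makes \<open>T *\<^sub>R u\<close> so long that
    \<open>p + T *\<^sub>R u\<close> is not in the open ball; the first ensures
    \<open>t \<le> T\<close>.\<close>
  define T where "T = t + 2 / norm u"
  have "T * norm u \<ge> 2"
    using t \<open>u \<noteq> 0\<close> by (simp add: T_def field_simps)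
  then have "norm (p + T *\<^sub>R u) \<ge> 1"
    using norm_diff_ineq[of "T *\<^sub>R u" p] p t by (simp add: add.commute T_def)
  moreover have "continuous_on {t..T} (\<lambda>s. norm (p + s *\<^sub>R u))"
    by (intro continuous_intros)
  ultimately obtain s where "t \<le> s" "norm (p + s *\<^sub>R u) = 1"
    using IVT'[of "\<lambda>s. norm (p + s *\<^sub>R u)" t 1 T] t by (auto simp: T_def)
  then show ?thesis using t unfolding u_def by (intro exI[of _ s]) auto
qed

context plane
begin

lemma norm_tang_pos: "norm (tang p e) > 0"
proof -
  have "\<eta> (tang p e) = 1" by (simp add: tang_def)
  then show ?thesis by auto
qed

lemma tangent_cone_indep:
  assumes "ddir p e + ddir p (- e) > 0" and "\<beta> *\<^sub>R tang p e + \<gamma> *\<^sub>R tang p (- e) = 0"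
  shows "\<beta> = 0 \<and> \<gamma> = 0"
proof -
  have "\<eta> (\<beta> *\<^sub>R tang p e + \<gamma> *\<^sub>R tang p (- e)) = \<beta> - \<gamma>"
    by (simp add: tang_def)
  then have "\<beta> = \<gamma>" using assms(2) by simp
  moreover have "\<xi> (\<beta> *\<^sub>R tang p e + \<gamma> *\<^sub>R tang p (- e)) = - (\<beta> * ddir p e + \<gamma> * ddir p (- e))"
    by (simp add: tang_def)
  ultimately have "\<beta> * (ddir p e + ddir p (- e)) = 0"
    unfolding assms(2) by (simp add: distrib_left)
  then show ?thesis using assms(1) \<open>\<beta> = \<gamma>\<close> by simp
qed

text \<open>At a corner \<open>p\<close> is a multiple of the sum of the two tangents, so
  \<open>p\<close> and then \<open>e\<close> can be recovered from them.\<close>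

lemma tangent_basis:
  assumes "ddir p e + ddir p (- e) > 0"
  shows "\<exists>\<beta> \<gamma>. x = \<beta> *\<^sub>R tang p e + \<gamma> *\<^sub>R tang p (- e)"
proof -
  define \<Delta> where "\<Delta> = ddir p e + ddir p (- e)"
  have "tang p e + tang p (- e) = (- \<Delta>) *\<^sub>R p" "\<Delta> \<noteq> 0"
    using assms by (simp_all add: tang_add_tang_minus \<Delta>_def)
  then have p: "p = (- (1 / \<Delta>)) *\<^sub>R (tang p e + tang p (- e))"
    by simp
  define k where "k = \<xi> x + \<eta> x * ddir p e"
  have "x = \<xi> x *\<^sub>R p + \<eta> x *\<^sub>R (tang p e + ddir p e *\<^sub>R p)"
    using coords[of x] by (simp add: tang_def)
  also have "\<dots> = k *\<^sub>R p + \<eta> x *\<^sub>R tang p e"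
    by (simp add: k_def algebra_simps)
  also have "k *\<^sub>R p = k *\<^sub>R ((- (1 / \<Delta>)) *\<^sub>R (tang p e + tang p (- e)))"
    using p by simp
  also have "\<dots> + \<eta> x *\<^sub>R tang p e = (\<eta> x - k / \<Delta>) *\<^sub>R tang p e + (- k / \<Delta>) *\<^sub>R tang p (- e)"
    by (simp add: algebra_simps)
  finally show ?thesis by blast
qed

text \<open>On this half-plane \<open>k\<close> equals \<open>1 - ddir p x\<close>, which is
  nonnegative in the ball. Since \<open>- p\<close> is a positive multiple of the sum of the two
  tangents, the term \<open>- k *\<^sub>R p\<close> stays in the cone. The other half-plane follows
  by flipping \<open>e\<close>.\<close>

lemma ball_subset_tangent_cone_aux:
  assumes corner: "ddir p e + ddir p (- e) > 0" and x: "norm x \<le> 1" "\<eta> x \<ge> 0"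
  shows "\<exists>\<beta>\<ge>0. \<exists>\<gamma>\<ge>0. x = p + \<beta> *\<^sub>R tang p e + \<gamma> *\<^sub>R tang p (- e)"
proof -
  define \<Delta> where "\<Delta> = ddir p e + ddir p (- e)"
  define k where "k = 1 - \<xi> x - \<eta> x * ddir p e"
  have "ddir p x = \<xi> x + \<eta> x * ddir p e"
    using ddir_shift[of p "\<xi> x" "\<eta> x *\<^sub>R e"] coords[of x] x(2) by (simp add: ddir_scaleR)
  then have k: "k \<ge> 0" using ddir_le_norm[of p x] x(1) by (simp add: k_def)
  have sum: "tang p e + tang p (- e) = (- \<Delta>) *\<^sub>R p" "\<Delta> \<noteq> 0"
    using corner by (simp_all add: tang_add_tang_minus \<Delta>_def)
  have "x = p + \<eta> x *\<^sub>R tang p e - k *\<^sub>R p"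
    by (subst coords[of x]) (simp add: k_def tang_def algebra_simps)
  also have "k *\<^sub>R p = (- (k / \<Delta>)) *\<^sub>R (tang p e + tang p (- e))"
    using sum by simp
  also have "p + \<eta> x *\<^sub>R tang p e - \<dots> = p + (\<eta> x + k / \<Delta>) *\<^sub>R tang p e + (k / \<Delta>) *\<^sub>R tang p (- e)"
    by (simp add: algebra_simps)
  finally have "x = p + (\<eta> x + k / \<Delta>) *\<^sub>R tang p e + (k / \<Delta>) *\<^sub>R tang p (- e)" .
  moreover have "k / \<Delta> \<ge> 0" using k corner by (simp add: \<Delta>_def)
  ultimately show ?thesis using x(2) by (meson add_nonneg_nonneg)
qed

lemma ball_subset_tangent_cone:
  assumes corner: "ddir p e + ddir p (- e) > 0" and x: "norm x \<le> 1"
  shows "\<exists>\<beta>\<ge>0. \<exists>\<gamma>\<ge>0. x = p + \<beta> *\<^sub>R tang p e + \<gamma> *\<^sub>R tang p (- e)"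
proof (cases "\<eta> x \<ge> 0")
  case True
  then show ?thesis using ball_subset_tangent_cone_aux assms by blast
next
  case False
  interpret m: plane p "- e" \<xi> "\<lambda>x. - \<eta> x" by (rule plane_minus)
  have "\<exists>\<beta>\<ge>0. \<exists>\<gamma>\<ge>0. x = p + \<beta> *\<^sub>R tang p (- e) + \<gamma> *\<^sub>R tang p (- (- e))"
    by (rule m.ball_subset_tangent_cone_aux) (use False assms in \<open>auto simp: add.commute\<close>)
  then show ?thesis by (metis add.assoc add.commute minus_minus)
qed

end

section \<open>Isometries between unit spheres\<close>

definition sphere_isometry :: "('a::real_normed_vector \<Rightarrow> 'b::real_normed_vector) \<Rightarrow> bool" where
  "sphere_isometry f \<longleftrightarrow> isometry_on (sphere 0 1) f \<and> f ` sphere 0 1 = sphere 0 1"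

lemma sphere_isometry_norm:
  assumes "sphere_isometry f" "norm x = 1"
  shows "norm (f x) = 1"
  using assms unfolding sphere_isometry_def by (metis image_eqI mem_sphere_0)

lemma sphere_isometry_dist:
  assumes "sphere_isometry f" "norm x = 1" "norm y = 1"
  shows "norm (f x - f y) = norm (x - y)"
  using assms by (auto simp: sphere_isometry_def isometry_on_def dist_norm)

lemma sphere_isometry_inj:
  assumes "sphere_isometry f"
  shows "inj_on f (sphere 0 1)"
proof (rule inj_onI)
  fix x y assume "x \<in> sphere 0 1" "y \<in> sphere 0 1" "f x = f y"
  then show "x = y"
    using sphere_isometry_dist[OF assms, of x y] by simp
qed

lemma sphere_isometry_continuous: "sphere_isometry f \<Longrightarrow> continuous_on (sphere 0 1) f"
  unfolding sphere_isometry_def isometry_on_def continuous_on_iff by metis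

lemma sphere_isometry_inv:
  assumes f: "sphere_isometry f"
  shows "sphere_isometry (inv_into (sphere 0 1) f)" (is "sphere_isometry ?g")
    and "norm x = 1 \<Longrightarrow> inv_into (sphere 0 1) f (f x) = x"
    and "norm y = 1 \<Longrightarrow> f (inv_into (sphere 0 1) f y) = y"
proof -
  have im: "f ` sphere 0 1 = sphere 0 1" using f by (simp add: sphere_isometry_def)
  show left: "?g (f x) = x" if "norm x = 1" for x
    using that sphere_isometry_inj[OF f] by simp
  show right: "f (?g y) = y" if "norm y = 1" for y
    using that im by (intro f_inv_into_f) auto
  have n: "norm (?g y) = 1" if "norm y = 1" for y
    using inv_into_into[of y f "sphere 0 1"] im that by auto
  have "?g ` sphere 0 1 = sphere 0 1"
    using inv_into_image_cancel[OF sphere_isometry_inj[OF f], of "sphere 0 1"] im by simp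
  moreover have "norm (?g y - ?g z) = norm (y - z)" if "norm y = 1" "norm z = 1" for y z
    using sphere_isometry_dist[OF f n[OF that(1)] n[OF that(2)]] right that by simp
  ultimately show "sphere_isometry ?g"
    by (simp add: sphere_isometry_def isometry_on_def dist_norm)
qed

text \<open>In the charts at \<open>p\<close> and \<open>q\<close> the isometry becomes a continuous
  injection of the line, hence is strictly monotone; its direction depends on the choice of
  \<open>e'\<close>.\<close>

lemma stereo_conjugate:
  assumes "plane p e \<xi> \<eta>" "plane q e' \<xi>' \<eta>'" and f: "sphere_isometry f" and fp: "f p = q"
  obtains \<tau> where "\<And>s. f (stereo p e s) = stereo q e' (\<tau> s)" "surj \<tau>"
    "strict_mono \<tau> \<or> strict_mono (\<lambda>s. - \<tau> s)"
proof -
  interpret X: plane p e \<xi> \<eta> by fact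
  interpret Y: plane q e' \<xi>' \<eta>' by fact
  define \<tau> where "\<tau> s = Y.unstereo (f (stereo p e s))" for s
  have neq: "f (stereo p e s) \<noteq> q" for s
    using sphere_isometry_inj[OF f] X.stereo_neq[of s] fp by (auto dest: inj_onD)
  have conj: "f (stereo p e s) = stereo q e' (\<tau> s)" for s
    using Y.stereo_unstereo[OF _ neq] sphere_isometry_norm[OF f] by (simp add: \<tau>_def)
  have cont: "continuous_on UNIV \<tau>"
    unfolding \<tau>_def
  proof (rule continuous_on_compose2[OF Y.continuous_on_unstereo])
    show "continuous_on UNIV (\<lambda>s. f (stereo p e s))"
      by (rule continuous_on_compose2[OF sphere_isometry_continuous[OF f] X.continuous_on_stereo]) auto
  qed (use neq sphere_isometry_norm[OF f] in auto)
  have "inj \<tau>"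
  proof (rule injI)
    fix s t assume "\<tau> s = \<tau> t"
    then have "f (stereo p e s) = f (stereo p e t)" by (simp add: conj)
    then have "stereo p e s = stereo p e t"
      using sphere_isometry_inj[OF f] by (auto dest: inj_onD)
    then show "s = t" by (metis X.unstereo_stereo)
  qed
  then have "strict_mono_on UNIV \<tau> \<or> strict_antimono_on UNIV \<tau>"
    using injective_eq_monotone_map[OF _ cont] by simp
  then have mono: "strict_mono \<tau> \<or> strict_mono (\<lambda>s. - \<tau> s)"
    by (auto simp: monotone_on_def)
  have "surj \<tau>"
  proof (rule surjI)
    fix y
    define z where "z = inv_into (sphere 0 1) f (stereo q e' y)"
    have z: "norm z = 1" "f z = stereo q e' y"
      using sphere_isometry_inv[OF f] sphere_isometry_norm[OF sphere_isometry_inv(1)[OF f], of "stereo q e' y"]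
      by (auto simp: z_def)
    then have "z \<noteq> p" using Y.stereo_neq[of y] fp by auto
    then show "\<tau> (X.unstereo z) = y"
      using z by (simp add: \<tau>_def X.stereo_unstereo Y.unstereo_stereo)
  qed
  with conj mono that show ?thesis by blast
qed

lemma strict_mono_surj_filterlim:
  fixes \<tau> :: "real \<Rightarrow> real"
  assumes "strict_mono \<tau>" "surj \<tau>"
  shows "filterlim \<tau> at_top at_top"
  unfolding filterlim_at_top
proof
  fix Z
  obtain s where "\<tau> s = Z" using assms(2) by (metis surjD)
  then show "\<forall>\<^sub>F x in at_top. Z \<le> \<tau> x"
    using monoD[OF strict_mono_mono[OF assms(1)]] by (auto intro: eventually_mono[OF eventually_ge_at_top[of s]])
qed

text \<open>Direction and length of the image chord are found separately. The image is the arc at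
  \<open>q\<close> run through with parameter \<open>h t\<close>, which tends to 0 from the right,
  so the directions converge to that of \<open>tang q e'\<close>; the lengths are those of the
  original chords.\<close>

lemma tangent_transfer:
  assumes "plane p e \<xi> \<eta>" "plane q e' \<xi>' \<eta>'" and f: "sphere_isometry f" and fp: "f p = q"
    and conj: "\<And>s. f (stereo p e s) = stereo q e' (\<tau> s)" and \<tau>: "filterlim \<tau> at_top at_top"
  shows "((\<lambda>t. (f (sphere_arc p e t) - q) /\<^sub>R t) \<longlongrightarrow> norm (tang p e) *\<^sub>R sgn (tang q e')) (at_right 0)"
proof -
  interpret X: plane p e \<xi> \<eta> by fact
  interpret Y: plane q e' \<xi>' \<eta>' by fact
  define h where "h t = 2 / \<tau> (2 / t)" for t
  have inv: "filterlim (\<lambda>t::real. 2 / t) at_top (at_right 0)"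
    using filterlim_tendsto_pos_mult_at_top[OF tendsto_const[of 2] _ filterlim_inverse_at_top_right]
    by (simp add: divide_inverse)
  have \<tau>': "filterlim (\<lambda>t. \<tau> (2 / t)) at_top (at_right 0)"
    by (rule filterlim_compose[OF \<tau> inv])
  have pos: "\<forall>\<^sub>F t in at_right 0. \<tau> (2 / t) > 0"
    using \<tau>' by (simp add: filterlim_at_top_dense)
  have h: "filterlim h (at_right 0) (at_right 0)"
    unfolding filterlim_at
  proof
    show "\<forall>\<^sub>F t in at_right 0. h t \<in> {0<..} \<and> h t \<noteq> 0"
      using pos by eventually_elim (simp add: h_def)
    show "(h \<longlongrightarrow> 0) (at_right 0)"
      unfolding h_def by (intro tendsto_divide_0[OF tendsto_const] filterlim_at_top_imp_at_infinity \<tau>')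
  qed
  have sgn: "((\<lambda>t. sgn ((sphere_arc q e' (h t) - q) /\<^sub>R h t)) \<longlongrightarrow> sgn (tang q e')) (at_right 0)"
    using Y.norm_tang_pos
    by (intro tendsto_sgn filterlim_compose[OF sphere_arc_tangent[OF Y.norm_p] h]) auto
  have norm: "((\<lambda>t. norm ((sphere_arc p e t - p) /\<^sub>R t)) \<longlongrightarrow> norm (tang p e)) (at_right 0)"
    by (rule tendsto_norm[OF sphere_arc_tangent[OF X.norm_p]])
  have "((\<lambda>t. norm ((sphere_arc p e t - p) /\<^sub>R t) *\<^sub>R sgn ((sphere_arc q e' (h t) - q) /\<^sub>R h t))
      \<longlongrightarrow> norm (tang p e) *\<^sub>R sgn (tang q e')) (at_right 0)"
    by (rule tendsto_scaleR[OF norm sgn])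
  moreover have "\<forall>\<^sub>F t in at_right 0. norm ((sphere_arc p e t - p) /\<^sub>R t) *\<^sub>R sgn ((sphere_arc q e' (h t) - q) /\<^sub>R h t)
      = (f (sphere_arc p e t) - q) /\<^sub>R t"
    using pos eventually_at_right_less[of "0::real"]
  proof eventually_elim
    case (elim t)
    have a: "sphere_arc p e t = stereo p e (2 / t)"
      using elim by (simp add: stereo_inverse)
    have b: "f (sphere_arc p e t) = sphere_arc q e' (h t)"
      unfolding a conj using elim stereo_inverse[of "h t" q e'] by (simp add: h_def)
    have "norm (sphere_arc p e t - p) = norm (sphere_arc q e' (h t) - q)"
      using sphere_isometry_dist[OF f, of "sphere_arc p e t" p] b fp by (simp add: a)
    then show ?case
      using elim unfolding b by (simp add: h_def sgn_scaleR sgn_div_norm)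
  qed
  ultimately show ?thesis by (rule Lim_transform_eventually)
qed

text \<open>Derivatives of the norm at a chord are metric data, so values computed at
  \<open>v\<close> bound the norm on the other side from below. Taking \<open>v\<close> in the
  direction \<open>u\<close> itself would leave an error if the norm has a kink there along
  \<open>C\<close>; hence the shift by \<open>r *\<^sub>R C\<close> and the limit as
  \<open>r\<close> tends to 0.\<close>

lemma tangent_cone_norm_le:
  fixes f :: "'a::real_normed_vector \<Rightarrow> 'b::real_normed_vector"
  assumes f: "sphere_isometry f" and p: "norm p = 1"
    and g: "\<forall>\<^sub>F t in at_right 0. norm (g t) = 1" "\<forall>\<^sub>F t in at_right 0. norm (h t) = 1"
    and tg: "((\<lambda>t. (g t - p) /\<^sub>R t) \<longlongrightarrow> B) (at_right 0)" "((\<lambda>t. (h t - p) /\<^sub>R t) \<longlongrightarrow> C) (at_right 0)"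
    and tg': "((\<lambda>t. (f (g t) - f p) /\<^sub>R t) \<longlongrightarrow> B') (at_right 0)" "((\<lambda>t. (f (h t) - f p) /\<^sub>R t) \<longlongrightarrow> C') (at_right 0)"
    and chord: "\<And>\<beta> \<gamma>. 0 < \<beta> \<Longrightarrow> 0 < \<gamma> \<Longrightarrow> \<exists>s>0. norm (p + s *\<^sub>R (\<beta> *\<^sub>R B + \<gamma> *\<^sub>R C)) = 1"
    and pos: "0 < \<beta>" "0 < \<gamma>"
  shows "norm (\<beta> *\<^sub>R B + \<gamma> *\<^sub>R C) \<le> norm (\<beta> *\<^sub>R B' + \<gamma> *\<^sub>R C')"
proof -
  \<comment> \<open>Both derivatives are limits of quotients formed from the distances of
    \<open>z\<close> to \<open>k t\<close> and to \<open>p\<close>.\<close>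
  have transfer: "ddir (z - p) (- K) = ddir (f z - f p) (- K')"
    if "norm z = 1" "\<forall>\<^sub>F t in at_right 0. norm (k t) = 1" "((\<lambda>t. (k t - p) /\<^sub>R t) \<longlongrightarrow> K) (at_right 0)"
      "((\<lambda>t. (f (k t) - f p) /\<^sub>R t) \<longlongrightarrow> K') (at_right 0)" for z k K K'
  proof (rule tendsto_unique[OF _ _ tendsto_ddir_chord[OF that(4)]])
    have "\<forall>\<^sub>F t in at_right 0. (norm (z - k t) - norm (z - p)) / t = (norm (f z - f (k t)) - norm (f z - f p)) / t"
      using that(2) by eventually_elim (simp add: sphere_isometry_dist f that p)
    then show "((\<lambda>t. (norm (f z - f (k t)) - norm (f z - f p)) / t) \<longlongrightarrow> ddir (z - p) (- K)) (at_right 0)"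
      by (rule Lim_transform_eventually[OF tendsto_ddir_chord[OF that(3)]])
  qed simp
  \<comment> \<open>The functional belonging to the chord in direction \<open>u + r *\<^sub>R C\<close> is at least \<open>lower r\<close> at \<open>u\<close>;
    \<open>lower r\<close> tends to \<open>norm u\<close> because \<open>Q\<close>, a one-sided difference quotient, has a limit.\<close>
  define u where "u = \<beta> *\<^sub>R B + \<gamma> *\<^sub>R C"
  define \<phi> where "\<phi> r = norm (u + r *\<^sub>R C)" for r
  define Q where "Q r = (norm (u + r *\<^sub>R C) - norm u) / r" for r
  define lower where "lower r = \<phi> r - (\<phi> (2 * r) - \<phi> r) - \<gamma> * (2 * Q (2 * r) - Q r - Q r)" for r
  have le: "lower r \<le> norm (\<beta> *\<^sub>R B' + \<gamma> *\<^sub>R C')" if r: "r > 0" for r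
  proof -
    define v where "v = \<beta> *\<^sub>R B + (\<gamma> + r) *\<^sub>R C"
    have v: "v = u + r *\<^sub>R C" by (simp add: v_def u_def algebra_simps)
    obtain s where s: "s > 0" "norm (p + s *\<^sub>R v) = 1"
      using chord[of \<beta> "\<gamma> + r"] pos r by (auto simp: v_def)
    define w where "w = f (p + s *\<^sub>R v) - f p"
    have eq: "ddir v (- B) = ddir w (- B')" "ddir v (- C) = ddir w (- C')"
      using transfer[OF s(2) g(1) tg(1) tg'(1)] transfer[OF s(2) g(2) tg(2) tg'(2)] s(1)
      by (simp_all add: w_def ddir_scaleR_base)
    \<comment> \<open>Solving for \<open>B\<close> trades the derivative along \<open>- B\<close>
      for one along \<open>C\<close>, up to a multiple of \<open>v\<close>, where the derivative is
      explicit.\<close>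
    have "\<beta> *\<^sub>R (- B) = (- 1) *\<^sub>R v + (\<gamma> + r) *\<^sub>R C" by (simp add: v_def algebra_simps)
    then have 1: "\<beta> * ddir v (- B) = - norm v + (\<gamma> + r) * ddir v C"
      using ddir_shift[of v "- 1" "(\<gamma> + r) *\<^sub>R C"] pos r
      by (simp add: ddir_scaleR[symmetric] del: scaleR_minus_right)
    have double: "v + r *\<^sub>R C = u + (2 * r) *\<^sub>R C" unfolding v mult_2 scaleR_left_distrib by (simp only: add.assoc)
    have "norm (v + r *\<^sub>R C) = \<phi> (2 * r)" "norm v = \<phi> r"
      by (simp_all only: \<phi>_def double) (simp only: v)
    moreover have "norm (v + r *\<^sub>R (- C)) = \<phi> 0"
      by (simp add: \<phi>_def v)
    ultimately have norms: "norm (v + r *\<^sub>R C) = \<phi> (2 * r)" "norm v = \<phi> r"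
      "norm (v + r *\<^sub>R (- C)) = \<phi> 0" .
    \<comment> \<open>Both steps have length \<open>r\<close>, forward to
      \<open>u + (2 * r) *\<^sub>R C\<close> and back to \<open>u\<close>; together they give a
      second difference that is small compared with \<open>r\<close>.\<close>
    have 2: "ddir v C \<le> (\<phi> (2 * r) - \<phi> r) / r"
      using ddir_le_quotient[OF r, of v C] by (simp only: norms)
    have 3: "ddir v (- C) \<le> (\<phi> 0 - \<phi> r) / r"
      using ddir_le_quotient[OF r, of v "- C"] by (simp only: norms)
    have "- norm (\<beta> *\<^sub>R B' + \<gamma> *\<^sub>R C') \<le> - ddir w (\<beta> *\<^sub>R B' + \<gamma> *\<^sub>R C')"
      using ddir_le_norm by simp
    also have "\<dots> \<le> ddir w (- (\<beta> *\<^sub>R B' + \<gamma> *\<^sub>R C'))"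
      using ddir_add_minus_nonneg[of w "\<beta> *\<^sub>R B' + \<gamma> *\<^sub>R C'"] by linarith
    also have "- (\<beta> *\<^sub>R B' + \<gamma> *\<^sub>R C') = \<beta> *\<^sub>R (- B') + \<gamma> *\<^sub>R (- C')" by simp
    also have "ddir w \<dots> \<le> ddir w (\<beta> *\<^sub>R (- B')) + ddir w (\<gamma> *\<^sub>R (- C'))"
      by (rule ddir_add_le)
    also have "\<dots> = \<beta> * ddir v (- B) + \<gamma> * ddir v (- C)"
      using pos by (simp add: ddir_scaleR eq del: scaleR_minus_right)
    also have "\<dots> = - norm v + (\<gamma> + r) * ddir v C + \<gamma> * ddir v (- C)"
      by (simp add: 1)
    also have "\<dots> \<le> - norm v + (\<gamma> + r) * ((\<phi> (2 * r) - \<phi> r) / r) + \<gamma> * ((\<phi> 0 - \<phi> r) / r)"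
      using 2 3 pos r by (intro add_mono mult_left_mono) auto
    also have "\<dots> = - lower r"
      using r unfolding norms by (simp add: lower_def Q_def \<phi>_def field_simps)
    finally show ?thesis by simp
  qed
  have Q: "(Q \<longlongrightarrow> ddir u C) (at_right 0)"
    unfolding Q_def by (rule ddir_tendsto)
  have dbl: "filterlim (\<lambda>r::real. 2 * r) (at_right 0) (at_right 0)"
    unfolding filterlim_at by (auto intro!: tendsto_eq_intros simp: eventually_at_filter)
  have \<phi>: "(\<phi> \<longlongrightarrow> norm u) (at_right 0)" "((\<lambda>r. \<phi> (2 * r)) \<longlongrightarrow> norm u) (at_right 0)"
    unfolding \<phi>_def by (auto intro!: tendsto_eq_intros)
  have "(lower \<longlongrightarrow> norm u - (norm u - norm u) - \<gamma> * (2 * ddir u C - ddir u C - ddir u C)) (at_right 0)"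
    unfolding lower_def by (intro tendsto_intros \<phi> Q filterlim_compose[OF Q dbl])
  then have "(lower \<longlongrightarrow> norm u) (at_right 0)" by simp
  then show ?thesis
    unfolding u_def[symmetric]
    by (rule tendsto_upperbound) (auto intro: eventually_mono[OF eventually_at_right_less] le)
qed

section \<open>The codomain is two-dimensional\<close>

text \<open>Without \<open>x\<close> the sphere is a copy of the line, and removing \<open>y\<close>
  cuts that line.\<close>

lemma sphere_minus_two_points_disconnected:
  fixes x y :: "'a::real_normed_vector"
  assumes "dim (UNIV :: 'a set) = 2" "norm x = 1" "norm y = 1" "x \<noteq> y"
  shows "\<not> connected (sphere 0 1 - {x, y})"
proof
  assume conn: "connected (sphere 0 1 - {x, y})"
  obtain e \<xi> \<eta> where "plane x e \<xi> \<eta>"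
    using ex_plane_of_dim_2 assms by blast
  then interpret plane x e \<xi> \<eta> .
  define s where "s = unstereo y"
  have y: "stereo x e s = y" using stereo_unstereo assms by (simp add: s_def)
  define K where "K = unstereo ` (sphere 0 1 - {x, y})"
  have "connected K"
    unfolding K_def
    by (rule connected_continuous_image[OF continuous_on_subset[OF continuous_on_unstereo] conn]) auto
  moreover have "r \<in> K" if "r \<noteq> s" for r
    unfolding K_def
  proof (rule image_eqI)
    show "r = unstereo (stereo x e r)" by (simp add: unstereo_stereo)
    show "stereo x e r \<in> sphere 0 1 - {x, y}"
      using stereo_neq[of r] y unstereo_stereo[of r] that s_def by auto
  qed
  then have "s - 1 \<in> K" "s + 1 \<in> K" by simp_all
  ultimately have "s \<in> K"
    using connectedD_interval[of K "s - 1" "s + 1" s] by simp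
  then obtain z where "z \<in> sphere 0 1 - {x, y}" "s = unstereo z" unfolding K_def by blast
  then show False using stereo_unstereo[of z] y by auto
qed

lemma not_in_span_segment:
  fixes q u v :: "'a::real_normed_vector"
  assumes "u \<notin> span {q}" "v \<notin> span {q, u}"
  shows "connected_component (- span {q}) u v"
  unfolding connected_component_def
proof (intro exI conjI)
  show "connected (closed_segment u v)" by (rule connected_segment)
  show "closed_segment u v \<subseteq> - span {q}"
  proof
    fix w assume "w \<in> closed_segment u v"
    then obtain t where w: "w = (1 - t) *\<^sub>R u + t *\<^sub>R v" by (auto simp: in_segment)
    have "w \<notin> span {q}"
    proof
      assume "w \<in> span {q}"
      then have "w \<in> span {q, u}" by (rule rev_subsetD[OF _ span_mono]) auto
      moreover have "(1 - t) *\<^sub>R u \<in> span {q, u}" by (intro span_scale span_base) simp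
      ultimately have "w - (1 - t) *\<^sub>R u \<in> span {q, u}" by (rule span_diff)
      then have "t *\<^sub>R v \<in> span {q, u}" by (simp add: w)
      then have "t = 0" using span_scale[of "t *\<^sub>R v" "{q, u}" "1 / t"] assms(2) by (cases "t = 0") auto
      then show False using w \<open>w \<in> span {q}\<close> assms(1) by simp
    qed
    then show "w \<in> - span {q}" by simp
  qed
qed simp_all

text \<open>Two vectors off the line through \<open>q\<close> are joined by a segment, or by two
  segments via a vector outside their common plane; \<open>sgn\<close> carries this to the sphere.
  If the space is itself a line, \<open>big\<close> is vacuous and the set is empty.\<close>

lemma connected_sphere_minus_antipodal:
  fixes q :: "'a::real_normed_vector"
  assumes q: "norm q = 1" and big: "\<And>u. u \<notin> span {q} \<Longrightarrow> \<exists>z. z \<notin> span {q, u}"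
  shows "connected (sphere 0 1 - {q, - q})"
proof -
  have "connected (- span {q})"
    unfolding connected_iff_connected_component
  proof (intro ballI)
    fix u v assume u: "u \<in> - span {q}" and v: "v \<in> - span {q}"
    show "connected_component (- span {q}) u v"
    proof (cases "v \<in> span {q, u}")
      case False
      then show ?thesis using u not_in_span_segment by auto
    next
      case True
      obtain z where z: "z \<notin> span {q, u}" using big u by auto
      have "span {q, v} \<subseteq> span {q, u}"
        using True by (intro span_minimal) (auto intro: span_base)
      then have "z \<notin> span {q, v}" using z by auto
      then have "connected_component (- span {q}) u z" "connected_component (- span {q}) v z"
        using not_in_span_segment u v z by auto
      then show ?thesis by (metis connected_component_sym connected_component_trans)
    qed
  qed
  moreover have "continuous_on (- span {q}) (sgn :: 'a \<Rightarrow> 'a)"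
    using span_zero[of "{q}"] by (intro continuous_on_sgn continuous_on_id) auto
  ultimately have "connected (sgn ` (- span {q}))"
    by (intro connected_continuous_image)
  moreover have "sgn ` (- span {q}) = sphere 0 1 - {q, - q}"
  proof (intro equalityI subsetI)
    fix y assume "y \<in> sgn ` (- span {q})"
    then obtain x where x: "x \<notin> span {q}" "y = sgn x" by auto
    then have "x \<noteq> 0" using span_zero by auto
    then have "x = norm x *\<^sub>R y" using x by (simp add: sgn_div_norm)
    then have "y \<noteq> q" "y \<noteq> - q"
      using x(1) by (auto simp: span_singleton) (metis rangeI scaleR_minus_left scaleR_minus_right)+
    then show "y \<in> sphere 0 1 - {q, - q}"
      using \<open>x \<noteq> 0\<close> x by (simp add: norm_sgn)
  next
    fix y assume y: "y \<in> sphere 0 1 - {q, - q}"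
    have "y \<notin> span {q}"
    proof
      assume "y \<in> span {q}"
      then obtain k where k: "y = k *\<^sub>R q" by (auto simp: span_singleton)
      then have "\<bar>k\<bar> = 1" using y q by simp
      then have "k = 1 \<or> k = -1" by linarith
      then show False using k y by auto
    qed
    moreover have "y = sgn y" using y by (simp add: sgn_div_norm)
    ultimately show "y \<in> sgn ` (- span {q})" by auto
  qed
  ultimately show ?thesis by simp
qed

text \<open>Otherwise the sphere without \<open>q\<close> and \<open>- q\<close> would be connected,
  while the inverse isometry maps it onto a circle-like sphere without two points.\<close>

lemma ex_plane_codomain:
  fixes f :: "'a::real_normed_vector \<Rightarrow> 'b::real_normed_vector" and q :: 'b
  assumes dim: "dim (UNIV :: 'a set) = 2" and f: "sphere_isometry f" and q: "norm q = 1"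
  shows "\<exists>e \<xi> \<eta>. plane q e \<xi> \<eta>"
proof (rule ccontr)
  assume no: "\<nexists>e \<xi> \<eta>. plane q e \<xi> \<eta>"
  define g where "g = inv_into (sphere 0 1) f"
  have g: "sphere_isometry g" unfolding g_def by (rule sphere_isometry_inv(1)[OF f])
  have "\<exists>z. z \<notin> span {q, u}" if "u \<notin> span {q}" for u
    using ex_plane[OF q that] no by blast
  then have "connected (sphere 0 1 - {q, - q})"
    by (rule connected_sphere_minus_antipodal[OF q])
  then have "connected (g ` (sphere 0 1 - {q, - q}))"
    by (intro connected_continuous_image continuous_on_subset[OF sphere_isometry_continuous[OF g]]) auto
  also have "g ` (sphere 0 1 - {q, - q}) = g ` sphere 0 1 - g ` {q, - q}"
    using sphere_isometry_inj[OF g] q by (intro inj_on_image_set_diff) auto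
  also have "\<dots> = sphere 0 1 - {g q, g (- q)}"
    using g by (simp add: sphere_isometry_def)
  finally have "connected (sphere 0 1 - {g q, g (- q)})" .
  moreover have "g q \<noteq> g (- q)"
    using sphere_isometry_dist[OF g, of q "- q"] q by (auto simp: norm_minus_commute scaleR_2[symmetric])
  ultimately show False
    using sphere_minus_two_points_disconnected[OF dim, of "g q" "g (- q)"] sphere_isometry_norm[OF g] q by simp
qed

section \<open>Corners\<close>

lemma support_functional_le_ddir:
  fixes \<phi> :: "'a::real_normed_vector \<Rightarrow>\<^sub>L real"
  assumes "blinfun_apply \<phi> p = 1" "norm \<phi> = 1" "norm p = 1"
  shows "blinfun_apply \<phi> x \<le> ddir p x"
proof (rule tendsto_lowerbound[OF ddir_tendsto])
  have "blinfun_apply \<phi> x \<le> (norm (p + t *\<^sub>R x) - norm p) / t" if "t > 0" for t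
  proof -
    have "1 + t * blinfun_apply \<phi> x = blinfun_apply \<phi> (p + t *\<^sub>R x)"
      using assms by (simp add: blinfun.add_right blinfun.scaleR_right)
    also have "\<dots> \<le> norm (p + t *\<^sub>R x)"
      using norm_blinfun[of \<phi> "p + t *\<^sub>R x"] assms by simp
    finally show ?thesis using that assms by (simp add: field_simps)
  qed
  then show "\<forall>\<^sub>F t in at_right 0. blinfun_apply \<phi> x \<le> (norm (p + t *\<^sub>R x) - norm p) / t"
    by (auto intro: eventually_mono[OF eventually_at_right_less])
qed simp

context plane
begin

text \<open>Here \<open>ddir p\<close> is linear and is itself a support functional. Every other one
  lies below it, and a linear functional below a linear one equals it.\<close>

lemma unique_support_functional:
  assumes "ddir p e + ddir p (- e) = 0"
  shows "\<exists>!\<phi>::'a \<Rightarrow>\<^sub>L real. blinfun_apply \<phi> p = 1 \<and> norm \<phi> = 1"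
proof -
  define F where "F x = \<xi> x + \<eta> x * ddir p e" for x
  have "bounded_linear F"
    unfolding F_def
    by (intro bounded_linear_add bounded_linear_\<xi> bounded_linear_mult_const bounded_linear_\<eta>)
  then have ap: "blinfun_apply (Blinfun F) = F" by (rule bounded_linear_Blinfun_apply)
  have "ddir p (c *\<^sub>R e) = c * ddir p e" for c
  proof (cases "c \<ge> 0")
    case False
    then show ?thesis
      using ddir_scaleR[of "- c" p "- e"] assms by (simp add: algebra_simps add_eq_0_iff)
  qed (rule ddir_scaleR)
  then have ddir: "ddir p x = F x" for x
    using ddir_shift[of p "\<xi> x" "\<eta> x *\<^sub>R e"] coords[of x] by (simp add: F_def)
  have F_minus: "F (- x) = - F x" for x by (simp add: F_def)
  have "\<bar>F x\<bar> \<le> norm x" for x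
    using ddir_le_norm[of p x] ddir_le_norm[of p "- x"] by (simp add: ddir F_minus abs_le_iff)
  then have "norm (Blinfun F) \<le> 1"
    by (intro norm_blinfun_bound) (auto simp: ap)
  moreover have "1 \<le> norm (Blinfun F)"
    using norm_blinfun[of "Blinfun F" p] by (simp add: ap F_def)
  ultimately have ex: "blinfun_apply (Blinfun F) p = 1 \<and> norm (Blinfun F) = 1"
    by (simp add: ap F_def)
  have "\<psi> = Blinfun F" if \<psi>: "blinfun_apply \<psi> p = 1 \<and> norm \<psi> = 1" for \<psi>
  proof (rule blinfun_eqI)
    fix x
    have "blinfun_apply \<psi> y \<le> F y" for y
      using support_functional_le_ddir[of \<psi> p y] \<psi> by (simp add: ddir)
    from this[of x] this[of "- x"] show "blinfun_apply \<psi> x = blinfun_apply (Blinfun F) x"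
      by (simp add: ap blinfun.minus_right F_minus)
  qed
  with ex show ?thesis by blast
qed

end

lemma not_smooth_imp_corner:
  assumes "dim (UNIV :: 'a::real_normed_vector set) = 2" "\<not> smooth_space TYPE('a)"
  shows "\<exists>(p::'a) e \<xi> \<eta>. plane p e \<xi> \<eta> \<and> ddir p e + ddir p (- e) > 0"
proof -
  obtain p :: 'a where p: "norm p = 1" "\<not> (\<exists>!\<phi>::'a \<Rightarrow>\<^sub>L real. blinfun_apply \<phi> p = 1 \<and> norm \<phi> = 1)"
    using assms(2) unfolding smooth_space_def Ball_def not_all not_imp mem_sphere_0 by blast
  obtain e \<xi> \<eta> where pl: "plane p e \<xi> \<eta>"
    using ex_plane_of_dim_2[OF assms(1) p(1)] by blast
  then have "ddir p e + ddir p (- e) \<noteq> 0"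
    using plane.unique_support_functional p(2) by blast
  then show ?thesis
    using pl ddir_add_minus_nonneg[of p e] by force
qed

section \<open>Isometries fixing a corner\<close>

text \<open>The orbit of \<open>s\<close> increases. If bounded it converges in the chart, otherwise
  its points on the sphere converge to \<open>p\<close>; in both cases the constant distance between
  consecutive points must be 0.\<close>

lemma monotone_conjugate_fixes:
  assumes "plane p e \<xi> \<eta>" and h: "sphere_isometry h"
    and conj: "\<And>s. h (stereo p e s) = stereo p e (\<tau> s)" and mono: "strict_mono \<tau>" and s: "s \<le> \<tau> s"
  shows "h (stereo p e s) = stereo p e s"
proof -
  interpret plane p e \<xi> \<eta> by fact
  define u where "u n = (\<tau> ^^ n) s" for n
  define x where "x n = stereo p e (u n)" for n
  have u: "u (Suc n) = \<tau> (u n)" for n by (simp add: u_def)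
  have "u n \<le> u (Suc n)" for n
    by (induction n) (use s strict_mono_less_eq[OF mono] in \<open>auto simp: u u_def\<close>)
  then have inc: "incseq u" by (rule incseq_SucI)
  have "\<exists>l. x \<longlonglongrightarrow> l"
  proof (cases "bdd_above (range u)")
    case True
    then have "u \<longlonglongrightarrow> (SUP n. u n)"
      using inc by (intro LIMSEQ_incseq_SUP)
    then have "x \<longlonglongrightarrow> stereo p e (SUP n. u n)"
      unfolding x_def using continuous_on_stereo
      by (intro isCont_tendsto_compose[of _ "stereo p e"]) (simp add: continuous_on_eq_continuous_at)
    then show ?thesis by blast
  next
    case False
    have "filterlim u at_top sequentially"
      unfolding filterlim_at_top
    proof
      fix Z
      obtain n where n: "Z < u n"
        using False unfolding bdd_above_def by (auto simp: not_le)
      have "Z \<le> u m" if "n \<le> m" for m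
        using incseqD[OF inc that] n by simp
      then show "\<forall>\<^sub>F n in sequentially. Z \<le> u n"
        by (rule eventually_sequentiallyI)
    qed
    then have "x \<longlonglongrightarrow> p"
      unfolding x_def by (rule filterlim_compose[OF stereo_tendsto_at_top[OF norm_p]])
    then show ?thesis by blast
  qed
  then obtain l where l: "x \<longlonglongrightarrow> l" by blast
  have lim: "(\<lambda>n. norm (x (Suc n) - x n)) \<longlonglongrightarrow> norm (l - l)"
    by (intro tendsto_intros l LIMSEQ_Suc)
  have x: "x (Suc n) = h (x n)" for n by (simp add: x_def u conj)
  have const: "norm (x (Suc n) - x n) = norm (x 1 - x 0)" for n
  proof (induction n)
    case (Suc n)
    have "norm (x (Suc (Suc n)) - x (Suc n)) = norm (x (Suc n) - x n)"
      unfolding x[of "Suc n"] x[of n] by (rule sphere_isometry_dist[OF h]) (simp_all add: x_def sphere_isometry_norm[OF h])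
    then show ?case using Suc by simp
  qed simp
  have "norm (x 1 - x 0) = norm (l - l)"
    using lim unfolding const LIMSEQ_const_iff .
  then show ?thesis using x[of 0] by (simp add: x_def u_def)
qed

text \<open>The hypothesis on the tangent rules out swapping the branches: then
  \<open>tang p e\<close> would be a nonnegative multiple of \<open>tang p (- e)\<close>, although
  their \<open>\<eta>\<close> coordinates are 1 and -1. For points moved downwards, flipping
  \<open>e\<close> reverses the line.\<close>

lemma sphere_isometry_eq_id:
  assumes "plane p e \<xi> \<eta>" and h: "sphere_isometry h" and hp: "h p = p"
    and tg: "((\<lambda>t. (h (sphere_arc p e t) - p) /\<^sub>R t) \<longlongrightarrow> tang p e) (at_right 0)"
    and z: "norm z = 1"
  shows "h z = z"
proof -
  interpret plane p e \<xi> \<eta> by fact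
  interpret m: plane p "- e" \<xi> "\<lambda>x. - \<eta> x" by (rule plane_minus)
  obtain \<tau> where conj: "\<And>s. h (stereo p e s) = stereo p e (\<tau> s)" and surj: "surj \<tau>"
    and mono: "strict_mono \<tau> \<or> strict_mono (\<lambda>s. - \<tau> s)"
    using stereo_conjugate[OF plane_axioms plane_axioms h hp] by blast
  have "\<not> strict_mono (\<lambda>s. - \<tau> s)"
  proof
    assume dec: "strict_mono (\<lambda>s. - \<tau> s)"
    have "surj (\<lambda>s. - \<tau> s)"
      using surj by (metis add.inverse_inverse surj_def)
    with dec have lim: "filterlim (\<lambda>s. - \<tau> s) at_top at_top"
      by (rule strict_mono_surj_filterlim)
    have conj': "h (stereo p e s) = stereo p (- e) (- \<tau> s)" for s
      by (simp add: conj stereo_minus)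
    have "tang p e = norm (tang p e) *\<^sub>R sgn (tang p (- e))"
      by (rule tendsto_unique[OF _ tg tangent_transfer[OF plane_axioms m.plane_axioms h hp conj' lim]]) simp
    then have "\<eta> (tang p e) = \<eta> (norm (tang p e) *\<^sub>R sgn (tang p (- e)))" by simp
    then have "1 = - (norm (tang p e) / norm (tang p (- e)))"
      by (simp add: tang_def sgn_div_norm divide_inverse mult.commute)
    moreover have "norm (tang p e) / norm (tang p (- e)) \<ge> 0" by simp
    ultimately show False by linarith
  qed
  with mono have mono: "strict_mono \<tau>" by blast
  show ?thesis
  proof (cases "z = p")
    case False
    define s where "s = unstereo z"
    have zs: "z = stereo p e s" using stereo_unstereo[OF z False] by (simp add: s_def)
    show ?thesis
    proof (cases "s \<le> \<tau> s")
      case True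
      then show ?thesis
        unfolding zs by (rule monotone_conjugate_fixes[OF plane_axioms h conj mono])
    next
      case False
      have "h (stereo p (- e) (- s)) = stereo p (- e) (- s)"
      proof (rule monotone_conjugate_fixes[OF m.plane_axioms h, where \<tau> = "\<lambda>s. - \<tau> (- s)"])
        show "strict_mono (\<lambda>s. - \<tau> (- s))"
          using mono by (simp add: strict_mono_def)
      qed (use False in \<open>simp_all add: stereo_minus conj\<close>)
      then show ?thesis by (simp add: zs stereo_minus)
    qed
  qed (simp add: hp)
qed

section \<open>The linear extension\<close>

lemma tangent_rescale:
  fixes g :: "real \<Rightarrow> 'a::real_normed_vector"
  assumes "((\<lambda>t. (g t - p) /\<^sub>R t) \<longlongrightarrow> B) (at_right 0)" "0 < c"
  shows "((\<lambda>t. (g (c * t) - p) /\<^sub>R t) \<longlongrightarrow> c *\<^sub>R B) (at_right 0)"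
proof -
  have "filterlim (\<lambda>t. c * t) (at_right 0) (at_right 0)"
    unfolding filterlim_at using assms(2) by (auto intro!: tendsto_eq_intros simp: eventually_at_filter)
  from tendsto_scaleR[OF tendsto_const[of c] filterlim_compose[OF assms(1) this]] show ?thesis
    using assms(2) by (simp flip: mult.assoc)
qed

text \<open>The points with parameters \<open>\<beta> * t\<close> and \<open>\<gamma> * t\<close> on
  the two branches keep their distance; dividing by \<open>t\<close> gives the claim in the
  limit.\<close>

lemma norm_tangent_diff_eq:
  fixes f :: "'a::real_normed_vector \<Rightarrow> 'b::real_normed_vector"
  assumes f: "sphere_isometry f"
    and g: "\<And>t. 0 < t \<Longrightarrow> norm (g t) = 1" "\<And>t. 0 < t \<Longrightarrow> norm (h t) = 1"
    and tg: "((\<lambda>t. (g t - p) /\<^sub>R t) \<longlongrightarrow> B) (at_right 0)" "((\<lambda>t. (h t - p) /\<^sub>R t) \<longlongrightarrow> C) (at_right 0)"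
    and tg': "((\<lambda>t. (f (g t) - q) /\<^sub>R t) \<longlongrightarrow> B') (at_right 0)" "((\<lambda>t. (f (h t) - q) /\<^sub>R t) \<longlongrightarrow> C') (at_right 0)"
    and pos: "0 < \<beta>" "0 < \<gamma>"
  shows "norm (\<beta> *\<^sub>R B - \<gamma> *\<^sub>R C) = norm (\<beta> *\<^sub>R B' - \<gamma> *\<^sub>R C')"
proof (rule tendsto_unique)
  let ?F = "\<lambda>t. norm ((g (\<beta> * t) - p) /\<^sub>R t - (h (\<gamma> * t) - p) /\<^sub>R t)"
  let ?G = "\<lambda>t. norm ((f (g (\<beta> * t)) - q) /\<^sub>R t - (f (h (\<gamma> * t)) - q) /\<^sub>R t)"
  show "(?F \<longlongrightarrow> norm (\<beta> *\<^sub>R B - \<gamma> *\<^sub>R C)) (at_right 0)"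
    by (intro tendsto_norm tendsto_diff tangent_rescale tg pos)
  have lim: "(?G \<longlongrightarrow> norm (\<beta> *\<^sub>R B' - \<gamma> *\<^sub>R C')) (at_right 0)"
    by (intro tendsto_norm tendsto_diff tangent_rescale[where g = "\<lambda>t. f (g t)"] tangent_rescale[where g = "\<lambda>t. f (h t)"] tg' pos)
  have "?G t = ?F t" if "t > 0" for t
  proof -
    have "norm (f (g (\<beta> * t)) - f (h (\<gamma> * t))) = norm (g (\<beta> * t) - h (\<gamma> * t))"
      using that pos by (intro sphere_isometry_dist f g) auto
    then show ?thesis
      by (simp add: scaleR_diff_right[symmetric])
  qed
  then have "\<forall>\<^sub>F t in at_right 0. ?G t = ?F t"
    by (auto intro: eventually_mono[OF eventually_at_right_less])
  then show "(?F \<longlongrightarrow> norm (\<beta> *\<^sub>R B' - \<gamma> *\<^sub>R C')) (at_right 0)"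
    by (rule Lim_transform_eventually[OF lim])
qed simp

lemma (in plane) norm_sphere_arc:
  assumes "0 < t"
  shows "norm (sphere_arc p e t) = 1"
  using norm_stereo[of "2 / t"] assms by (simp add: stereo_inverse)

text \<open>Replacing \<open>e'\<close> by \<open>- e'\<close> if necessary makes the branch of
  \<open>e\<close> go to the branch of \<open>e''\<close>.\<close>

lemma ex_monotone_conjugate:
  assumes "plane p e \<xi> \<eta>" "plane q e' \<xi>' \<eta>'" "sphere_isometry f" "f p = q"
  obtains e'' \<eta>'' \<tau> where "plane q e'' \<xi>' \<eta>''" "\<And>s. f (stereo p e s) = stereo q e'' (\<tau> s)"
    "surj \<tau>" "strict_mono \<tau>"
proof -
  obtain \<tau> where \<tau>: "\<And>s. f (stereo p e s) = stereo q e' (\<tau> s)" "surj \<tau>"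
    "strict_mono \<tau> \<or> strict_mono (\<lambda>s. - \<tau> s)"
    using stereo_conjugate[OF assms] by blast
  show ?thesis
  proof (cases "strict_mono \<tau>")
    case True
    then show ?thesis using that[OF assms(2) \<tau>(1,2)] by blast
  next
    case False
    have "f (stereo p e s) = stereo q (- e') (- \<tau> s)" for s
      by (simp add: \<tau>(1) stereo_minus)
    moreover have "surj (\<lambda>s. - \<tau> s)"
      using \<tau>(2) by (metis add.inverse_inverse surj_def)
    ultimately show ?thesis
      using that[OF plane.plane_minus[OF assms(2)], of "\<lambda>s. - \<tau> s"] \<tau>(3) False by blast
  qed
qed

text \<open>Coefficients of equal sign are handled by the cone estimate for \<open>f\<close> and its
  inverse, those of opposite sign by distances between the branches, and a zero coefficient by
  equality of lengths.\<close>

lemma tangent_cone_norm_eq: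
  fixes f :: "'a::real_normed_vector \<Rightarrow> 'b::real_normed_vector"
  assumes pl: "plane p e \<xi> \<eta>" and pl': "plane q e' \<xi>' \<eta>'"
    and f: "sphere_isometry f" and fp: "f p = q"
    and conj: "\<And>s. f (stereo p e s) = stereo q e' (\<tau> s)" and \<tau>: "surj \<tau>" "strict_mono \<tau>"
    and corner: "ddir p e + ddir p (- e) > 0"
  shows "ddir q e' + ddir q (- e') > 0"
    and "((\<lambda>t. (f (sphere_arc p e t) - q) /\<^sub>R t) \<longlongrightarrow> norm (tang p e) *\<^sub>R sgn (tang q e')) (at_right 0)"
    and "norm (\<beta> *\<^sub>R tang p e + \<gamma> *\<^sub>R tang p (- e))
      = norm (\<beta> *\<^sub>R norm (tang p e) *\<^sub>R sgn (tang q e') + \<gamma> *\<^sub>R norm (tang p (- e)) *\<^sub>R sgn (tang q (- e')))"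
proof -
  interpret X: plane p e \<xi> \<eta> by fact
  interpret Y: plane q e' \<xi>' \<eta>' by fact
  interpret mX: plane p "- e" \<xi> "\<lambda>x. - \<eta> x" by (rule X.plane_minus)
  interpret mY: plane q "- e'" \<xi>' "\<lambda>x. - \<eta>' x" by (rule Y.plane_minus)
  define B C B' C' where defs: "B = tang p e" "C = tang p (- e)"
    "B' = norm B *\<^sub>R sgn (tang q e')" "C' = norm C *\<^sub>R sgn (tang q (- e'))"
  define g h where gh: "g = sphere_arc p e" "h = sphere_arc p (- e)"
  have BC: "norm B > 0" "norm C > 0" unfolding defs by (rule X.norm_tang_pos mX.norm_tang_pos)+
  have tg: "((\<lambda>t. (g t - p) /\<^sub>R t) \<longlongrightarrow> B) (at_right 0)" "((\<lambda>t. (h t - p) /\<^sub>R t) \<longlongrightarrow> C) (at_right 0)"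
    unfolding defs gh by (intro sphere_arc_tangent X.norm_p)+
  have gh1: "norm (g t) = 1" "norm (h t) = 1" if "0 < t" for t
    unfolding gh using that by (rule X.norm_sphere_arc mX.norm_sphere_arc)+
  show tgB: "((\<lambda>t. (f (sphere_arc p e t) - q) /\<^sub>R t) \<longlongrightarrow> norm (tang p e) *\<^sub>R sgn (tang q e')) (at_right 0)"
    by (rule tangent_transfer[OF pl pl' f fp conj strict_mono_surj_filterlim[OF \<tau>(2,1)]])
  \<comment> \<open>This is the conjugate of \<open>f\<close> in the charts with \<open>- e\<close>
    and \<open>- e'\<close>; it gives the derivative along the other branch.\<close>
  have "strict_mono (\<lambda>s. - \<tau> (- s))" using \<tau>(2) by (simp add: strict_mono_def)
  moreover have "surj (\<lambda>s. - \<tau> (- s))"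
  proof (rule surjI)
    show "- \<tau> (- (- inv \<tau> (- y))) = y" for y
      using surj_f_inv_f[OF \<tau>(1)] by simp
  qed
  ultimately have "filterlim (\<lambda>s. - \<tau> (- s)) at_top at_top"
    by (rule strict_mono_surj_filterlim)
  then have "((\<lambda>t. (f (h t) - q) /\<^sub>R t) \<longlongrightarrow> C') (at_right 0)"
    unfolding defs gh
    by (intro tangent_transfer[OF mX.plane_axioms mY.plane_axioms f fp]) (simp_all add: stereo_minus conj)
  with tgB have tg': "((\<lambda>t. (f (g t) - q) /\<^sub>R t) \<longlongrightarrow> B') (at_right 0)" "((\<lambda>t. (f (h t) - q) /\<^sub>R t) \<longlongrightarrow> C') (at_right 0)"
    by (simp_all add: defs gh)
  have ev: "\<forall>\<^sub>F t in at_right 0. P t" if "\<And>t. 0 < t \<Longrightarrow> P t" for P :: "real \<Rightarrow> bool"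
    using that by (auto intro: eventually_mono[OF eventually_at_right_less])
  have le: "norm (\<beta> *\<^sub>R B + \<gamma> *\<^sub>R C) \<le> norm (\<beta> *\<^sub>R B' + \<gamma> *\<^sub>R C')" if "0 < \<beta>" "0 < \<gamma>" for \<beta> \<gamma>
  proof (rule tangent_cone_norm_le[OF f X.norm_p _ _ tg _ _ _ that, unfolded fp])
    show "\<exists>s>0. norm (p + s *\<^sub>R (\<beta> *\<^sub>R B + \<gamma> *\<^sub>R C)) = 1" if "0 < \<beta>" "0 < \<gamma>" for \<beta> \<gamma>
      unfolding defs by (rule tangent_cone_chord[OF X.norm_p corner that])
  qed (use gh1 tg' in \<open>auto intro: ev\<close>)
  \<comment> \<open>Without a corner at \<open>q\<close> the tangents there would be opposite, and
    \<open>le\<close> would make \<open>B\<close> and \<open>C\<close> dependent.\<close>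
  show corner': "ddir q e' + ddir q (- e') > 0"
  proof (rule ccontr)
    assume "\<not> ?thesis"
    then have "ddir q e' + ddir q (- e') = 0"
      using ddir_add_minus_nonneg[of q e'] by linarith
    then have "tang q (- e') = - tang q e'"
      using tang_add_tang_minus[of q e'] by (simp add: add_eq_0_iff)
    then have "(1 / norm B) *\<^sub>R B' + (1 / norm C) *\<^sub>R C' = 0"
      using BC by (simp add: defs(3,4) sgn_minus)
    then have "(1 / norm B) *\<^sub>R B + (1 / norm C) *\<^sub>R C = 0"
      using le[of "1 / norm B" "1 / norm C"] BC by simp
    then have "1 / norm B = 0"
      using X.tangent_cone_indep[OF corner] unfolding defs by blast
    then show False using BC by simp
  qed
  define k where "k = inv_into (sphere 0 1) f"
  have k: "sphere_isometry k" "\<And>x. norm x = 1 \<Longrightarrow> k (f x) = x"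
    using sphere_isometry_inv[OF f] by (simp_all add: k_def)
  have kq: "k q = p" using k(2)[of p] fp by simp
  \<comment> \<open>The reverse estimate uses \<open>corner'\<close>: only now is it known that
    chords fill the cone of \<open>B'\<close> and \<open>C'\<close>, positive multiples of the
    tangents at \<open>q\<close>.\<close>
  have ge: "norm (\<beta> *\<^sub>R B' + \<gamma> *\<^sub>R C') \<le> norm (\<beta> *\<^sub>R B + \<gamma> *\<^sub>R C)" if "0 < \<beta>" "0 < \<gamma>" for \<beta> \<gamma>
  proof (rule tangent_cone_norm_le[OF k(1) Y.norm_p _ _ tg' _ _ _ that, unfolded kq])
    show "\<exists>s>0. norm (q + s *\<^sub>R (\<beta> *\<^sub>R B' + \<gamma> *\<^sub>R C')) = 1" if "0 < \<beta>" "0 < \<gamma>" for \<beta> \<gamma>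
    proof -
      have "\<beta> *\<^sub>R B' + \<gamma> *\<^sub>R C' = (\<beta> * norm B / norm (tang q e')) *\<^sub>R tang q e' + (\<gamma> * norm C / norm (tang q (- e'))) *\<^sub>R tang q (- e')"
        by (simp add: defs(3,4) sgn_div_norm divide_inverse mult.assoc)
      then show ?thesis
        using tangent_cone_chord[OF Y.norm_p corner', of "\<beta> * norm B / norm (tang q e')" "\<gamma> * norm C / norm (tang q (- e'))"]
          that BC Y.norm_tang_pos mY.norm_tang_pos by (simp only: divide_pos_pos mult_pos_pos)
    qed
    show "((\<lambda>t. (k (f (g t)) - p) /\<^sub>R t) \<longlongrightarrow> B) (at_right 0)"
      by (rule Lim_transform_eventually[OF tg(1)]) (auto intro!: ev simp: k gh1)
    show "((\<lambda>t. (k (f (h t)) - p) /\<^sub>R t) \<longlongrightarrow> C) (at_right 0)"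
      by (rule Lim_transform_eventually[OF tg(2)]) (auto intro!: ev simp: k gh1)
  qed (auto intro!: ev sphere_isometry_norm[OF f] gh1)
  have pos: "norm (\<beta> *\<^sub>R B + \<gamma> *\<^sub>R C) = norm (\<beta> *\<^sub>R B' + \<gamma> *\<^sub>R C')" if "0 < \<beta>" "0 < \<gamma>" for \<beta> \<gamma>
    using le[OF that] ge[OF that] by simp
  have diff: "norm (\<beta> *\<^sub>R B - \<gamma> *\<^sub>R C) = norm (\<beta> *\<^sub>R B' - \<gamma> *\<^sub>R C')" if "0 < \<beta>" "0 < \<gamma>" for \<beta> \<gamma>
    by (rule norm_tangent_diff_eq[OF f gh1 tg tg' that])
  have norms: "norm B' = norm B" "norm C' = norm C"
    using BC Y.norm_tang_pos mY.norm_tang_pos by (simp_all add: defs(3,4) norm_sgn)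
  have nonneg: "norm (\<beta> *\<^sub>R B + \<gamma> *\<^sub>R C) = norm (\<beta> *\<^sub>R B' + \<gamma> *\<^sub>R C')" if \<beta>: "0 \<le> \<beta>" for \<beta> \<gamma>
  proof (cases "\<beta> = 0 \<or> \<gamma> = 0")
    case True
    then show ?thesis by (auto simp: norms)
  next
    case False
    then show ?thesis
      using pos[of \<beta> \<gamma>] diff[of \<beta> "- \<gamma>"] \<beta> by (cases "\<gamma> > 0") auto
  qed
  have "norm (\<beta> *\<^sub>R B + \<gamma> *\<^sub>R C) = norm (\<beta> *\<^sub>R B' + \<gamma> *\<^sub>R C')"
  proof (cases "0 \<le> \<beta>")
    case False
    have "norm (\<beta> *\<^sub>R B + \<gamma> *\<^sub>R C) = norm ((- \<beta>) *\<^sub>R B + (- \<gamma>) *\<^sub>R C)"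
      using norm_minus_cancel[of "\<beta> *\<^sub>R B + \<gamma> *\<^sub>R C"] by simp
    also have "\<dots> = norm ((- \<beta>) *\<^sub>R B' + (- \<gamma>) *\<^sub>R C')"
      using False by (intro nonneg) simp
    also have "\<dots> = norm (\<beta> *\<^sub>R B' + \<gamma> *\<^sub>R C')"
      using norm_minus_cancel[of "\<beta> *\<^sub>R B' + \<gamma> *\<^sub>R C'"] by simp
    finally show ?thesis .
  qed (rule nonneg)
  then show "norm (\<beta> *\<^sub>R tang p e + \<gamma> *\<^sub>R tang p (- e))
      = norm (\<beta> *\<^sub>R norm (tang p e) *\<^sub>R sgn (tang q e') + \<gamma> *\<^sub>R norm (tang p (- e)) *\<^sub>R sgn (tang q (- e')))"
    by (simp add: defs)
qed

lemma sphere_isometry_extends: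
  fixes f :: "'a::real_normed_vector \<Rightarrow> 'b::real_normed_vector" and p :: 'a
  assumes dim: "dim (UNIV :: 'a set) = 2" and f: "sphere_isometry f"
    and pl: "plane p e \<xi> \<eta>" and corner: "ddir p e + ddir p (- e) > 0"
  shows "\<exists>T. linear T \<and> isometry_on UNIV T \<and> surj T \<and> (\<forall>x\<in>sphere 0 1. T x = f x)"
proof -
  interpret X: plane p e \<xi> \<eta> by fact
  define q where "q = f p"
  have "norm q = 1" using sphere_isometry_norm[OF f X.norm_p] by (simp add: q_def)
  then obtain e0 \<xi>' \<eta>0 where pl0: "plane q e0 \<xi>' \<eta>0"
    using ex_plane_codomain[OF dim f] by blast
  obtain e' \<eta>' \<tau> where pl': "plane q e' \<xi>' \<eta>'" and conj: "\<And>s. f (stereo p e s) = stereo q e' (\<tau> s)"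
    and \<tau>: "surj \<tau>" "strict_mono \<tau>"
    using ex_monotone_conjugate[OF pl pl0 f q_def[symmetric]] by blast
  interpret Y: plane q e' \<xi>' \<eta>' by fact
  interpret mX: plane p "- e" \<xi> "\<lambda>x. - \<eta> x" by (rule X.plane_minus)
  interpret mY: plane q "- e'" \<xi>' "\<lambda>x. - \<eta>' x" by (rule Y.plane_minus)
  note eq = tangent_cone_norm_eq[OF pl pl' f q_def[symmetric] conj \<tau> corner]
  define B C where BC: "B = tang p e" "C = tang p (- e)"
  define b c where bc: "b = norm B / norm (tang q e')" "c = norm C / norm (tang q (- e'))"
  have bc_pos: "b > 0" "c > 0"
    using X.norm_tang_pos Y.norm_tang_pos mX.norm_tang_pos mY.norm_tang_pos by (simp_all add: BC bc)
  define B' C' where BC': "B' = b *\<^sub>R tang q e'" "C' = c *\<^sub>R tang q (- e')"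
  have B': "B' = norm (tang p e) *\<^sub>R sgn (tang q e')" and C': "C' = norm (tang p (- e)) *\<^sub>R sgn (tang q (- e'))"
    by (simp_all add: BC BC' bc sgn_div_norm divide_inverse)
  have norm_eq: "norm (\<beta> *\<^sub>R B + \<gamma> *\<^sub>R C) = norm (\<beta> *\<^sub>R B' + \<gamma> *\<^sub>R C')" for \<beta> \<gamma>
    using eq(3)[of \<beta> \<gamma>] by (simp only: B' C' BC)
  \<comment> \<open>The forced image of \<open>p\<close>, because \<open>B + C\<close> is
    \<open>- (ddir p e + ddir p (- e)) *\<^sub>R p\<close>. Likewise
    \<open>e = B + ddir p e *\<^sub>R p\<close> dictates the second summand of
    \<open>T\<close>.\<close>
  define P' where "P' = (- (1 / (ddir p e + ddir p (- e)))) *\<^sub>R (B' + C')"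
  define T where "T x = \<xi> x *\<^sub>R P' + \<eta> x *\<^sub>R (B' + ddir p e *\<^sub>R P')" for x
  have lin: "linear T"
    by (rule linearI) (simp_all add: T_def algebra_simps)
  have TB: "T B = B'"
    by (simp add: T_def BC tang_def algebra_simps)
  have TC: "T C = C'"
  proof -
    have "T C = - B' - (ddir p e + ddir p (- e)) *\<^sub>R P'"
      by (simp add: T_def BC tang_def algebra_simps)
    also have "\<dots> = C'" using corner by (simp add: P'_def)
    finally show ?thesis .
  qed
  have T: "T (\<beta> *\<^sub>R B + \<gamma> *\<^sub>R C) = \<beta> *\<^sub>R B' + \<gamma> *\<^sub>R C'" for \<beta> \<gamma>
    by (simp add: linear_add[OF lin] linear_scale[OF lin] TB TC)
  have norm_T: "norm (T x) = norm x" for x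
  proof -
    obtain \<beta> \<gamma> where "x = \<beta> *\<^sub>R B + \<gamma> *\<^sub>R C"
      using X.tangent_basis[OF corner] unfolding BC by blast
    then show ?thesis using norm_eq T by simp
  qed
  have "inj T"
    by (rule injI) (metis linear_diff[OF lin] norm_T norm_eq_zero right_minus_eq)
  have "surj T"
    unfolding surj_def
  proof
    fix y
    obtain \<beta> \<gamma> where "y = \<beta> *\<^sub>R tang q e' + \<gamma> *\<^sub>R tang q (- e')"
      using Y.tangent_basis[OF eq(1)] by blast
    then have "y = T ((\<beta> / b) *\<^sub>R B + (\<gamma> / c) *\<^sub>R C)"
      unfolding T using bc_pos by (simp add: BC')
    then show "\<exists>x. y = T x" by blast
  qed
  \<comment> \<open>\<open>T p\<close> lies in the tangent cone with apex \<open>q\<close>, and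
    \<open>q\<close> in the image cone with apex \<open>T p\<close>. Adding the two displacements
    gives a vanishing combination with nonnegative coefficients, and independence of the tangents
    makes them all 0.\<close>
  have Tp: "T p = q"
  proof -
    obtain \<beta> \<gamma> where 1: "\<beta> \<ge> 0" "\<gamma> \<ge> 0" "T p = q + \<beta> *\<^sub>R tang q e' + \<gamma> *\<^sub>R tang q (- e')"
      using Y.ball_subset_tangent_cone[OF eq(1), of "T p"] norm_T[of p] by auto
    obtain x where x: "T x = q" using \<open>surj T\<close> by (metis surjD)
    then have "norm x \<le> 1" using norm_T[of x] by simp
    then obtain \<beta>' \<gamma>' where 2: "\<beta>' \<ge> 0" "\<gamma>' \<ge> 0" "x = p + \<beta>' *\<^sub>R B + \<gamma>' *\<^sub>R C"
      using X.ball_subset_tangent_cone[OF corner, of x] unfolding BC by blast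
    have "q = T p + T (\<beta>' *\<^sub>R B + \<gamma>' *\<^sub>R C)"
      using x 2(3) by (simp add: linear_add[OF lin] add.assoc)
    then have "(\<beta> + \<beta>' * b) *\<^sub>R tang q e' + (\<gamma> + \<gamma>' * c) *\<^sub>R tang q (- e') = 0"
      unfolding T 1(3) BC' by (simp add: algebra_simps)
    then have "\<beta> + \<beta>' * b = 0" "\<gamma> + \<gamma>' * c = 0"
      using Y.tangent_cone_indep[OF eq(1)] by blast+
    moreover have "\<beta>' * b \<ge> 0" "\<gamma>' * c \<ge> 0" using 2 bc_pos by simp_all
    ultimately have "\<beta> = 0" "\<gamma> = 0" using 1 by linarith+
    then show ?thesis using 1(3) by simp
  qed
  define U where "U = inv T"
  have TU: "T (U y) = y" for y using surj_f_inv_f[OF \<open>surj T\<close>] by (simp add: U_def)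
  have UT: "U (T x) = x" for x using inv_f_f[OF \<open>inj T\<close>] by (simp add: U_def)
  have U_diff: "U (x - y) = U x - U y" for x y
    by (metis TU UT linear_diff[OF lin])
  have U_scale: "U (r *\<^sub>R x) = r *\<^sub>R U x" for r x
    by (metis TU UT linear_scale[OF lin])
  have norm_U: "norm (U y) = norm y" for y
    by (metis TU norm_T)
  have iso: "sphere_isometry (\<lambda>x. U (f x))"
    unfolding sphere_isometry_def isometry_on_def
  proof (intro conjI ballI)
    fix x y :: 'a assume "x \<in> sphere 0 1" "y \<in> sphere 0 1"
    then show "dist (U (f x)) (U (f y)) = dist x y"
      by (simp add: dist_norm U_diff[symmetric] norm_U sphere_isometry_dist[OF f])
  next
    show "(\<lambda>x. U (f x)) ` sphere 0 1 = sphere 0 1"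
    proof (intro equalityI subsetI)
      fix z :: 'a assume "z \<in> sphere 0 1"
      then have "T z \<in> f ` sphere 0 1"
        using f norm_T[of z] unfolding sphere_isometry_def by simp
      then obtain x where x: "x \<in> sphere 0 1" "T z = f x" by auto
      then have "z = U (f x)" using UT[of z] by simp
      then show "z \<in> (\<lambda>x. U (f x)) ` sphere 0 1" using x(1) by (rule image_eqI)
    next
      fix z assume "z \<in> (\<lambda>x. U (f x)) ` sphere 0 1"
      then obtain x where "x \<in> sphere 0 1" "z = U (f x)" by (rule imageE)
      then show "z \<in> sphere 0 1" by (simp add: norm_U sphere_isometry_norm[OF f])
    qed
  qed
  have fixed: "U (f p) = p" using UT[of p] Tp by (simp add: q_def)
  \<comment> \<open>\<open>U\<close> is linear and isometric and takes \<open>q\<close> to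
    \<open>p\<close> and \<open>B'\<close> to \<open>B\<close>, so it carries the known limit for
    \<open>f\<close> back to \<open>tang p e\<close>.\<close>
  have tangent: "((\<lambda>t. (U (f (sphere_arc p e t)) - p) /\<^sub>R t) \<longlongrightarrow> tang p e) (at_right 0)"
  proof -
    have norm: "norm ((U (f (sphere_arc p e t)) - p) /\<^sub>R t - B) = norm ((f (sphere_arc p e t) - q) /\<^sub>R t - B')" for t
    proof -
      have "U ((f (sphere_arc p e t) - q) /\<^sub>R t - B') = (U (f (sphere_arc p e t)) - p) /\<^sub>R t - B"
        using UT[of p] UT[of B] by (simp add: U_diff U_scale Tp TB)
      then show ?thesis by (metis norm_U)
    qed
    have "((\<lambda>t. norm ((f (sphere_arc p e t) - q) /\<^sub>R t - B')) \<longlongrightarrow> 0) (at_right 0)"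
      using tendsto_norm_zero[OF LIM_zero[OF eq(2)]] by (simp add: B')
    then have "((\<lambda>t. norm ((U (f (sphere_arc p e t)) - p) /\<^sub>R t - B)) \<longlongrightarrow> 0) (at_right 0)"
      by (simp only: norm)
    from LIM_zero_cancel[OF tendsto_norm_zero_cancel[OF this]] show ?thesis
      by (simp only: BC)
  qed
  have "U (f z) = z" if "norm z = 1" for z
    by (rule sphere_isometry_eq_id[OF pl iso fixed tangent that])
  then have "T z = f z" if "z \<in> sphere 0 1" for z
    using that TU[of "f z"] by simp
  moreover have "isometry_on UNIV T"
    by (simp add: isometry_on_def dist_norm linear_diff[OF lin, symmetric] norm_T)
  ultimately show ?thesis
    using lin \<open>surj T\<close> by blast
qed

theorem theorem1p4:
  assumes "dim (UNIV :: 'a::banach set) = 2"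
    and "\<not> smooth_space TYPE('a)"
  shows "Mazur_Ulam_property TYPE('a) TYPE('b::banach)"
proof -
  obtain p :: 'a and e \<xi> \<eta> where "plane p e \<xi> \<eta>" "ddir p e + ddir p (- e) > 0"
    using not_smooth_imp_corner[OF assms] by blast
  then show ?thesis
    unfolding Mazur_Ulam_property_def sphere_isometry_def[symmetric]
    using sphere_isometry_extends[OF assms(1)] by blast
qed

end
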